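(* Let $\epsilon_{\boxtimes}$ be the linear form on $\bigoplus_{k=0}^{\infty}\mathbb{C}[\mathcal{P}_k/\mathfrak{S}_k]$ which sends, for any $k\in\mathbb{N}$ (including $k=0$, with $\mathrm{id}_0=\emptyset$), the orbit of $\mathrm{id}_k$ on $1$, and the orbit of any other partition on $0$. Then $$\Big(\bigoplus_{k=0}^{\infty}\mathbb{C}[\mathcal{P}_k/\mathfrak{S}_k],\ \otimes,\ \{\emptyset\},\ \Delta_{\boxtimes},\ \epsilon_{\boxtimes}\Big)$$ (with product $\otimes$, unit $\{\emptyset\}$, coproduct $\Delta_{\boxtimes}$ and counit $\epsilon_{\boxtimes}$) is an associative and co-associative bi-algebra.
   Context: $\mathcal{P}_k$ is the set of partitions of $\{1,\dots,k\}\cup\{1',\dots,k'\}$ ($1,\dots,k$ form the top row, $1',\dots,k'$ the bottom row), $\mathcal{P}_0=\{\emptyset\}$, $\mathrm{id}_k=\{\{i,i'\}:1\le i\le k\}$. $\mathfrak{S}_k$ acts on $\mathcal{P}_k$ by simultaneously permuting the labels $1,\dots,k$ and $1',\dots,k'$ (conjugation $p\mapsto\sigma\circ p\circ\sigma^{-1}$); $[p]$ denotes the orbit of $p$ and $\mathcal{P}_k/\mathfrak{S}_k$ the set of orbits, a basis of $\mathbb{C}[\mathcal{P}_k/\mathfrak{S}_k]$. For $p\in\mathcal{P}_k$, $q\in\mathcal{P}_l$, $p\otimes q\in\mathcal{P}_{k+l}$ is obtained by placing $q$ to the right of $p$ (labels $i,i'$ of $q$ become $k+i,(k+i)'$). The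 product is $[p]\otimes[q]=[p\otimes q]$, extended bilinearly; it does not depend on the representatives. Composition: to form $p\circ p'$ ($p,p'\in\mathcal{P}_k$), put a diagram of $p'$ above a diagram of $p$ and identify the bottom vertex $i'$ of $p'$ with the top vertex $i$ of $p$; $p\circ p'$ is the partition of the top and bottom rows induced by the connected components of the resulting three-row graph, and $\kappa(p,p')$ is the number of connected components entirely contained in the middle row. $\mathrm{nc}(p)$ is the number of blocks of $p$, $p\vee p'$ the finest partition coarser than $p$ and $p'$, $d(p,p')=\frac12(\mathrm{nc}(p)+\mathrm{nc}(p'))-\mathrm{nc}(p\vee p')$. For $p,p'\in\mathcal{P}_k$, the Kreweras complement $\mathsf{K}_p(p')$ is the set of $p''\in\mathcal{P}_k$ such that $p=p'\circ p''$ and $$d(\mathrm{id}_k,p)=d(\mathrm{id}_k,p')+d(\mathrm{id}_k,p'')-\frac{k+\mathrm{nc}(p)-\mathrm{nc}(p')-\mathrm{nc}(p'')}{2}-\kappa(p',p'').$$ The coproduct is the linear extension of $$\Delta_{\boxtimes}([p])=\sum_{p_1,p_2\in\mathcal{P}_k\,:\,p_1\circ p_2=p,\ p_2\in\mathsf{K}_{p_1\circ p_2}(p_1)}[p_1]\otimes[p_2]\in\Big(\bigoplus_{k}\mathbb{C}[\mathcal{P}_k/\mathfrak{S}_k]\Big)\otimes\Big(\bigoplus_{k}\mathbb{C}[\mathcal{P}_k/\mathfrak{S}_k]\Big),\qquad p\in\mathcal{P}_k.$$ *)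

theory Defs
  imports
    Complex_Main
    "HOL-Library.Disjoint_Sets"
    "HOL-Library.Poly_Mapping"
    "HOL-Combinatorics.Permutations"
begin

section \<open>Bialgebras on free complex vector spaces\<close>

text \<open>
  The complex vector space with basis \<open>'a\<close> is the type \<open>'a \<Rightarrow>\<^sub>0 complex\<close> of finitely supported
  functions, and the tensor product of the spaces with bases \<open>'a\<close> and \<open>'b\<close> is the space with
  basis \<open>'a \<times> 'b\<close>; its universal property is proved below.
\<close>

definition scale :: "complex \<Rightarrow> ('a \<Rightarrow>\<^sub>0 complex) \<Rightarrow> ('a \<Rightarrow>\<^sub>0 complex)" where
  "scale c v = Poly_Mapping.map ((*) c) v"

abbreviation basis :: "'a \<Rightarrow> ('a \<Rightarrow>\<^sub>0 complex)" where
  "basis x \<equiv> Poly_Mapping.single x 1"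

text \<open>Linear extension of a map defined on the basis, into a vector space with scalar
  multiplication \<open>s\<close>.\<close>

definition lin_ext ::
  "(complex \<Rightarrow> 'b \<Rightarrow> 'b) \<Rightarrow> ('a \<Rightarrow> 'b) \<Rightarrow> ('a \<Rightarrow>\<^sub>0 complex) \<Rightarrow> 'b::comm_monoid_add" where
  "lin_ext s f v = (\<Sum>x\<in>Poly_Mapping.keys v. s (Poly_Mapping.lookup v x) (f x))"

definition bilin_ext ::
  "('a \<Rightarrow> 'b \<Rightarrow> ('c \<Rightarrow>\<^sub>0 complex)) \<Rightarrow> ('a \<Rightarrow>\<^sub>0 complex) \<Rightarrow> ('b \<Rightarrow>\<^sub>0 complex) \<Rightarrow> ('c \<Rightarrow>\<^sub>0 complex)" where
  "bilin_ext f v w = lin_ext scale (\<lambda>x. lin_ext scale (f x) w) v"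

definition bilinear_map ::
  "(('a \<Rightarrow>\<^sub>0 complex) \<Rightarrow> ('b \<Rightarrow>\<^sub>0 complex) \<Rightarrow> ('c \<Rightarrow>\<^sub>0 complex)) \<Rightarrow> bool" where
  "bilinear_map B \<longleftrightarrow>
     (\<forall>v. Vector_Spaces.linear scale scale (B v)) \<and>
     (\<forall>w. Vector_Spaces.linear scale scale (\<lambda>v. B v w))"

definition tensor ::
  "('a \<Rightarrow>\<^sub>0 complex) \<Rightarrow> ('b \<Rightarrow>\<^sub>0 complex) \<Rightarrow> (('a \<times> 'b) \<Rightarrow>\<^sub>0 complex)" (infixr "\<otimes>\<^sub>t" 70) where
  "v \<otimes>\<^sub>t w = bilin_ext (\<lambda>x y. basis (x, y)) v w"

text \<open>The linear map on the tensor product induced by a bilinear map.\<close>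

definition tensor_lift ::
  "(('a \<Rightarrow>\<^sub>0 complex) \<Rightarrow> ('b \<Rightarrow>\<^sub>0 complex) \<Rightarrow> ('c \<Rightarrow>\<^sub>0 complex))
     \<Rightarrow> (('a \<times> 'b) \<Rightarrow>\<^sub>0 complex) \<Rightarrow> ('c \<Rightarrow>\<^sub>0 complex)" where
  "tensor_lift B = lin_ext scale (\<lambda>(x, y). B (basis x) (basis y))"

definition tensor_map ::
  "(('a \<Rightarrow>\<^sub>0 complex) \<Rightarrow> ('c \<Rightarrow>\<^sub>0 complex)) \<Rightarrow> (('b \<Rightarrow>\<^sub>0 complex) \<Rightarrow> ('d \<Rightarrow>\<^sub>0 complex))
     \<Rightarrow> (('a \<times> 'b) \<Rightarrow>\<^sub>0 complex) \<Rightarrow> (('c \<times> 'd) \<Rightarrow>\<^sub>0 complex)" where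
  "tensor_map f g = tensor_lift (\<lambda>v w. f v \<otimes>\<^sub>t g w)"

definition tensor_assoc ::
  "((('a \<times> 'b) \<times> 'c) \<Rightarrow>\<^sub>0 complex) \<Rightarrow> (('a \<times> 'b \<times> 'c) \<Rightarrow>\<^sub>0 complex)" where
  "tensor_assoc = lin_ext scale (\<lambda>((x, y), z). basis (x, y, z))"

text \<open>The multiplication \<open>(a \<otimes> b) (c \<otimes> d) = (a c) \<otimes> (b d)\<close> on the tensor square of an algebra.\<close>

definition tensor_mult ::
  "(('a \<Rightarrow>\<^sub>0 complex) \<Rightarrow> ('a \<Rightarrow>\<^sub>0 complex) \<Rightarrow> ('a \<Rightarrow>\<^sub>0 complex))
     \<Rightarrow> (('a \<times> 'a) \<Rightarrow>\<^sub>0 complex) \<Rightarrow> (('a \<times> 'a) \<Rightarrow>\<^sub>0 complex) \<Rightarrow> (('a \<times> 'a) \<Rightarrow>\<^sub>0 complex)" where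
  "tensor_mult m s t =
     tensor_lift (\<lambda>a b. tensor_lift (\<lambda>c d. m a c \<otimes>\<^sub>t m b d) t) s"

locale unital_algebra =
  fixes mult :: "('a \<Rightarrow>\<^sub>0 complex) \<Rightarrow> ('a \<Rightarrow>\<^sub>0 complex) \<Rightarrow> ('a \<Rightarrow>\<^sub>0 complex)"
    and unit :: "'a \<Rightarrow>\<^sub>0 complex"
  assumes mult_bilinear: "bilinear_map mult"
    and mult_assoc: "mult (mult u v) w = mult u (mult v w)"
    and mult_unit_left: "mult unit v = v"
    and mult_unit_right: "mult v unit = v"

locale counital_coalgebra =
  fixes comult :: "('a \<Rightarrow>\<^sub>0 complex) \<Rightarrow> (('a \<times> 'a) \<Rightarrow>\<^sub>0 complex)"
    and counit :: "('a \<Rightarrow>\<^sub>0 complex) \<Rightarrow> complex"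
  assumes comult_linear: "Vector_Spaces.linear scale scale comult"
    and counit_linear: "Vector_Spaces.linear scale (*) counit"
    and comult_coassoc:
      "tensor_assoc (tensor_map comult id (comult v)) = tensor_map id comult (comult v)"
    and counit_left: "tensor_lift (\<lambda>u w. scale (counit u) w) (comult v) = v"
    and counit_right: "tensor_lift (\<lambda>u w. scale (counit w) u) (comult v) = v"

locale bialgebra =
  unital_algebra mult unit + counital_coalgebra comult counit
  for mult :: "('a \<Rightarrow>\<^sub>0 complex) \<Rightarrow> ('a \<Rightarrow>\<^sub>0 complex) \<Rightarrow> ('a \<Rightarrow>\<^sub>0 complex)"
    and unit :: "'a \<Rightarrow>\<^sub>0 complex"
    and comult :: "('a \<Rightarrow>\<^sub>0 complex) \<Rightarrow> (('a \<times> 'a) \<Rightarrow>\<^sub>0 complex)"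
    and counit :: "('a \<Rightarrow>\<^sub>0 complex) \<Rightarrow> complex" +
  assumes comult_mult: "comult (mult u v) = tensor_mult mult (comult u) (comult v)"
    and comult_unit: "comult unit = unit \<otimes>\<^sub>t unit"
    and counit_mult: "counit (mult u v) = counit u * counit v"
    and counit_unit: "counit unit = 1"

subsection \<open>Universal property of the tensor product\<close>

lemma lookup_scale [simp]: "Poly_Mapping.lookup (scale c v) x = c * Poly_Mapping.lookup v x"
  by (simp add: scale_def Poly_Mapping.map.rep_eq when_def)

lemma vector_space_scale: "vector_space scale"
  by unfold_locales (auto intro!: poly_mapping_eqI simp: lookup_add algebra_simps)

lemma vector_space_complex: "vector_space ((*) :: complex \<Rightarrow> _)"
  by unfold_locales (auto simp: algebra_simps)

lemma lin_ext_superset: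
  assumes "vector_space s" "finite A" "Poly_Mapping.keys v \<subseteq> A"
  shows "lin_ext s f v = (\<Sum>x\<in>A. s (Poly_Mapping.lookup v x) (f x))"
proof -
  interpret vector_space s by fact
  show ?thesis
    unfolding lin_ext_def using assms(2,3)
    by (intro sum.mono_neutral_left) (auto simp: in_keys_iff)
qed

lemma lin_ext_linear:
  assumes "vector_space s"
  shows "Vector_Spaces.linear scale s (lin_ext s f)"
proof -
  interpret S: vector_space s by fact
  have add: "lin_ext s f (v + w) = lin_ext s f v + lin_ext s f w" for v w
  proof -
    let ?A = "Poly_Mapping.keys v \<union> Poly_Mapping.keys w"
    have "lin_ext s f u = (\<Sum>x\<in>?A. s (Poly_Mapping.lookup u x) (f x))"
      if "u \<in> {v, w, v + w}" for u
      using that by (intro lin_ext_superset[OF assms]) (auto dest: subsetD[OF keys_add])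
    then show ?thesis
      by (simp add: lookup_add S.scale_left_distrib sum.distrib)
  qed
  have sc: "lin_ext s f (scale c v) = s c (lin_ext s f v)" for c v
  proof -
    have "lin_ext s f (scale c v)
        = (\<Sum>x\<in>Poly_Mapping.keys v. s (Poly_Mapping.lookup (scale c v) x) (f x))"
      by (intro lin_ext_superset[OF assms]) (auto simp: in_keys_iff)
    then show ?thesis
      by (simp add: lin_ext_def S.scale_sum_right)
  qed
  show ?thesis
    unfolding Vector_Spaces.linear_iff using add sc assms vector_space_scale by blast
qed

lemma lin_ext_basis: "vector_space s \<Longrightarrow> lin_ext s f (basis x) = f x"
  by (simp add: lin_ext_def vector_space.vector_space_assms)

lemma lin_ext_unique:
  assumes "Vector_Spaces.linear scale s g" "\<And>x. g (basis x) = f x"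
  shows "g = lin_ext s f"
proof
  fix v :: "'a \<Rightarrow>\<^sub>0 complex"
  interpret g: Vector_Spaces.linear scale s g by fact
  have "v = (\<Sum>x\<in>Poly_Mapping.keys v. scale (Poly_Mapping.lookup v x) (basis x))"
  proof (rule poly_mapping_eqI)
    fix y
    have "Poly_Mapping.lookup (\<Sum>x\<in>Poly_Mapping.keys v. scale (Poly_Mapping.lookup v x) (basis x)) y
        = (\<Sum>x\<in>Poly_Mapping.keys v. if x = y then Poly_Mapping.lookup v x else 0)"
      unfolding lookup_sum by (intro sum.cong) (auto simp: lookup_single when_def)
    then show "Poly_Mapping.lookup v y
        = Poly_Mapping.lookup (\<Sum>x\<in>Poly_Mapping.keys v. scale (Poly_Mapping.lookup v x) (basis x)) y"
      by (auto simp: in_keys_iff)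
  qed
  then have "g v = (\<Sum>x\<in>Poly_Mapping.keys v. s (Poly_Mapping.lookup v x) (g (basis x)))"
    by (metis (no_types, lifting) g.scale g.sum sum.cong)
  then show "g v = lin_ext s f v"
    by (simp add: assms(2) lin_ext_def)
qed

lemma linear_lin_ext_fun:
  assumes "\<And>x. Vector_Spaces.linear scale scale (\<lambda>w. f w x)"
  shows "Vector_Spaces.linear scale scale (\<lambda>w. lin_ext scale (f w) v)"
proof -
  interpret V: vector_space scale by (rule vector_space_scale)
  show ?thesis
    using assms unfolding Vector_Spaces.linear_iff lin_ext_def
    by (auto simp: V.scale_right_distrib sum.distrib V.scale_sum_right mult.commute)
qed

lemma bilinear_bilin_ext: "bilinear_map (bilin_ext f)"
  unfolding bilinear_map_def bilin_ext_def
  by (auto intro!: linear_lin_ext_fun lin_ext_linear vector_space_scale)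

lemma bilin_ext_basis: "bilin_ext f (basis x) (basis y) = f x y"
  by (simp add: bilin_ext_def lin_ext_basis vector_space_scale)

lemma bilinear_tensor: "bilinear_map (\<otimes>\<^sub>t)"
  unfolding tensor_def by (rule bilinear_bilin_ext)

lemma tensor_basis: "basis x \<otimes>\<^sub>t basis y = basis (x, y)"
  by (simp add: tensor_def bilin_ext_basis)

lemma bilinear_eqI:
  assumes "bilinear_map B" "bilinear_map C" "\<And>x y. B (basis x) (basis y) = C (basis x) (basis y)"
  shows "B v w = C v w"
proof -
  have ext: "D v w = lin_ext scale (\<lambda>x. lin_ext scale (\<lambda>y. D (basis x) (basis y)) w) v"
    if "bilinear_map D" for D :: "('a \<Rightarrow>\<^sub>0 complex) \<Rightarrow> ('b \<Rightarrow>\<^sub>0 complex) \<Rightarrow> ('c \<Rightarrow>\<^sub>0 complex)"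
  proof -
    have lin: "Vector_Spaces.linear scale scale (D v)" "Vector_Spaces.linear scale scale (\<lambda>v. D v w)"
      for v w
      using that by (simp_all add: bilinear_map_def)
    have "D v w = lin_ext scale (\<lambda>x. D (basis x) w) v"
      by (rule fun_cong[OF lin_ext_unique[OF lin(2) refl]])
    moreover have "D (basis x) w = lin_ext scale (\<lambda>y. D (basis x) (basis y)) w" for x
      by (rule fun_cong[OF lin_ext_unique[OF lin(1) refl]])
    ultimately show ?thesis
      by simp
  qed
  show ?thesis
    unfolding ext[OF assms(1)] ext[OF assms(2)] assms(3) ..
qed

theorem tensor_universal:
  assumes "bilinear_map B"
  shows "Vector_Spaces.linear scale scale (tensor_lift B)"
    and "tensor_lift B (v \<otimes>\<^sub>t w) = B v w"
    and "\<lbrakk>Vector_Spaces.linear scale scale h; \<And>v w. h (v \<otimes>\<^sub>t w) = B v w\<rbrakk> \<Longrightarrow> h = tensor_lift B"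
proof -
  show lin: "Vector_Spaces.linear scale scale (tensor_lift B)"
    unfolding tensor_lift_def by (intro lin_ext_linear vector_space_scale)
  have "bilinear_map (\<lambda>v w. tensor_lift B (v \<otimes>\<^sub>t w))"
    unfolding bilinear_map_def
  proof (intro conjI allI)
    show "Vector_Spaces.linear scale scale (\<lambda>w. tensor_lift B (v \<otimes>\<^sub>t w))" for v
      by (rule Vector_Spaces.linear_compose[OF _ lin, unfolded o_def])
        (rule bilinear_tensor[unfolded bilinear_map_def, THEN conjunct1, THEN spec])
    show "Vector_Spaces.linear scale scale (\<lambda>v. tensor_lift B (v \<otimes>\<^sub>t w))" for w
      by (rule Vector_Spaces.linear_compose[OF _ lin, unfolded o_def])
        (rule bilinear_tensor[unfolded bilinear_map_def, THEN conjunct2, THEN spec])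
  qed
  then show "tensor_lift B (v \<otimes>\<^sub>t w) = B v w"
    by (rule bilinear_eqI[OF _ assms])
      (simp add: tensor_basis tensor_lift_def lin_ext_basis vector_space_scale)
  show "h = tensor_lift B"
    if "Vector_Spaces.linear scale scale h" "\<And>v w. h (v \<otimes>\<^sub>t w) = B v w"
    unfolding tensor_lift_def
  proof (rule lin_ext_unique[OF that(1)])
    fix z :: "'a \<times> 'b"
    have "h (basis (fst z) \<otimes>\<^sub>t basis (snd z)) = B (basis (fst z)) (basis (snd z))"
      by (rule that(2))
    then show "h (basis z) = (case z of (x, y) \<Rightarrow> B (basis x) (basis y))"
      by (simp add: tensor_basis case_prod_unfold)
  qed
qed

section \<open>Partition diagrams\<close>

datatype 'a vertex = Top 'a | Bottom 'a

definition vertices :: "nat \<Rightarrow> nat vertex set" where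
  "vertices k = Top ` {1..k} \<union> Bottom ` {1..k}"

type_synonym diagram = "nat vertex set set"

definition diagrams :: "nat \<Rightarrow> diagram set" where
  "diagrams k = {p. partition_on (vertices k) p}"

definition id_diagram :: "nat \<Rightarrow> diagram" where
  "id_diagram k = {{Top i, Bottom i} |i. i \<in> {1..k}}"

definition relabel :: "(nat \<Rightarrow> nat) \<Rightarrow> diagram \<Rightarrow> diagram" where
  "relabel \<sigma> p = (`) (map_vertex \<sigma>) ` p"

definition juxtapose :: "nat \<Rightarrow> diagram \<Rightarrow> diagram \<Rightarrow> diagram" where
  "juxtapose k p q = p \<union> relabel (\<lambda>i. k + i) q"

text \<open>The connected components of the graph on \<open>\<Union>A\<close> in which two vertices are adjacent iff
  they lie in a common member of \<open>A\<close>.\<close>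

definition components :: "'a set set \<Rightarrow> 'a set set" where
  "components A = \<Union>A // {(x, y). \<exists>B\<in>A. x \<in> B \<and> y \<in> B}\<^sup>+"

subsection \<open>Composition\<close>

datatype 'a node = Upper 'a | Middle 'a | Lower 'a

fun upper_node :: "'a vertex \<Rightarrow> 'a node" where
  "upper_node (Top i) = Upper i"
| "upper_node (Bottom i) = Middle i"

fun lower_node :: "'a vertex \<Rightarrow> 'a node" where
  "lower_node (Top i) = Middle i"
| "lower_node (Bottom i) = Lower i"

fun outer_node :: "'a vertex \<Rightarrow> 'a node" where
  "outer_node (Top i) = Upper i"
| "outer_node (Bottom i) = Lower i"

text \<open>In \<open>p \<circ> p'\<close> the right-hand factor \<open>p'\<close> is placed on top.\<close>

definition stack_components :: "diagram \<Rightarrow> diagram \<Rightarrow> nat node set set" where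
  "stack_components p p' = components ((`) upper_node ` p' \<union> (`) lower_node ` p)"

definition compose :: "diagram \<Rightarrow> diagram \<Rightarrow> diagram" where
  "compose p p' = (\<lambda>C. outer_node -` C) ` stack_components p p' - {{}}"

definition kappa :: "diagram \<Rightarrow> diagram \<Rightarrow> nat" where
  "kappa p p' = card {C \<in> stack_components p p'. C \<subseteq> range Middle}"

subsection \<open>The distance and the Kreweras complement\<close>

definition nc :: "diagram \<Rightarrow> nat" where
  "nc p = card p"

definition join :: "nat \<Rightarrow> diagram \<Rightarrow> diagram \<Rightarrow> diagram" where
  "join k p p' = (THE r. refines (vertices k) p r \<and> refines (vertices k) p' r \<and>
     (\<forall>s. refines (vertices k) p s \<and> refines (vertices k) p' s \<longrightarrow> refines (vertices k) r s))"

definition dist_diagram :: "nat \<Rightarrow> diagram \<Rightarrow> diagram \<Rightarrow> real" where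
  "dist_diagram k p p' = (real (nc p) + real (nc p')) / 2 - real (nc (join k p p'))"

definition kreweras :: "nat \<Rightarrow> diagram \<Rightarrow> diagram \<Rightarrow> diagram set" where
  "kreweras k p p' = {p'' \<in> diagrams k. p = compose p' p'' \<and>
     dist_diagram k (id_diagram k) p =
       dist_diagram k (id_diagram k) p' + dist_diagram k (id_diagram k) p''
       - (real k + real (nc p) - real (nc p') - real (nc p'')) / 2 - real (kappa p' p'')}"

definition factorizations :: "nat \<Rightarrow> diagram \<Rightarrow> (diagram \<times> diagram) set" where
  "factorizations k p = {(p1, p2). p1 \<in> diagrams k \<and> p2 \<in> diagrams k \<and>
     compose p1 p2 = p \<and> p2 \<in> kreweras k (compose p1 p2) p1}"

section \<open>Orbits under simultaneous relabelling\<close>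

definition conj_rel :: "nat \<times> diagram \<Rightarrow> nat \<times> diagram \<Rightarrow> bool" where
  "conj_rel = (\<lambda>(k, p) (l, q). k = l \<and> p \<in> diagrams k \<and> (\<exists>\<sigma>. \<sigma> permutes {1..k} \<and> q = relabel \<sigma> p))"

subsection \<open>Independence of representatives\<close>

lemma conj_rel_iff: "conj_rel x y \<longleftrightarrow> fst x = fst y \<and> snd x \<in> diagrams (fst x) \<and>
    (\<exists>\<sigma>. \<sigma> permutes {1..fst x} \<and> snd y = relabel \<sigma> (snd x))"
  by (auto simp: conj_rel_def split: prod.splits)

lemma finite_diagrams: "finite (diagrams k)"
proof (rule finite_subset)
  show "diagrams k \<subseteq> Pow (Pow (vertices k))"
    by (auto simp: diagrams_def dest: partition_onD1)
  show "finite (Pow (Pow (vertices k)))"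
    by (simp add: vertices_def)
qed

lemma relabel_id [simp]: "relabel id p = p"
  by (simp add: relabel_def vertex.map_id0)

lemma relabel_relabel: "relabel \<sigma> (relabel \<tau> p) = relabel (\<sigma> \<circ> \<tau>) p"
  by (simp add: relabel_def image_image vertex.map_comp)

lemma relabel_inv: "\<sigma> permutes S \<Longrightarrow> relabel (inv \<sigma>) (relabel \<sigma> p) = p"
  by (simp add: relabel_relabel permutes_inv_o)

lemma relabel_inv': "\<sigma> permutes S \<Longrightarrow> relabel \<sigma> (relabel (inv \<sigma>) p) = p"
  by (simp add: relabel_relabel permutes_inv_o)

lemma inj_map_vertex: "\<sigma> permutes S \<Longrightarrow> inj (map_vertex \<sigma>)"
  by (simp add: vertex.inj_map permutes_inj)

lemma map_vertex_vertices:
  assumes "\<sigma> permutes {1..k}" shows "map_vertex \<sigma> ` vertices k = vertices k"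
proof -
  have "map_vertex \<sigma> ` Top ` {1..k} = Top ` \<sigma> ` {1..k}"
    "map_vertex \<sigma> ` Bottom ` {1..k} = Bottom ` \<sigma> ` {1..k}"
    by (simp_all add: image_image)
  then show ?thesis
    unfolding vertices_def image_Un permutes_image[OF assms] by (rule arg_cong2)
qed

lemma inj_image_set: "inj f \<Longrightarrow> inj ((`) f)"
  by (simp add: inj_on_def inj_image_eq_iff)

lemma relabel_partition_on:
  assumes "inj f" "partition_on A p"
  shows "partition_on (map_vertex f ` A) (relabel f p)"
proof -
  have "partition_on (map_vertex f ` A) ((`) (map_vertex f) ` p - {{}})"
    by (rule partition_on_inj_image[OF assms(2) inj_on_subset[OF vertex.inj_map[OF assms(1)]]]) simp
  moreover have "{} \<notin> (`) (map_vertex f) ` p"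
    using partition_onD3[OF assms(2)] by auto
  ultimately show ?thesis
    by (simp add: relabel_def)
qed

lemma relabel_diagrams: "\<sigma> permutes {1..k} \<Longrightarrow> p \<in> diagrams k \<Longrightarrow> relabel \<sigma> p \<in> diagrams k"
  using relabel_partition_on[of \<sigma> "vertices k" p]
  by (simp add: diagrams_def map_vertex_vertices permutes_inj)

lemma nc_relabel: "\<sigma> permutes S \<Longrightarrow> nc (relabel \<sigma> p) = nc p"
  unfolding nc_def relabel_def
  by (rule card_image) (rule inj_on_subset[OF inj_image_set[OF inj_map_vertex] subset_UNIV])

lemma relabel_id_diagram:
  assumes "\<sigma> permutes {1..k}" shows "relabel \<sigma> (id_diagram k) = id_diagram k"
proof -
  have id: "id_diagram k = (\<lambda>i. {Top i, Bottom i}) ` {1..k}"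
    unfolding id_diagram_def by blast
  have "relabel \<sigma> (id_diagram k) = (\<lambda>i. {Top i, Bottom i}) ` \<sigma> ` {1..k}"
    unfolding relabel_def id image_image by simp
  then show ?thesis
    unfolding permutes_image[OF assms] id .
qed

lemma components_image:
  assumes "inj f"
  shows "components ((`) f ` A) = (`) f ` components A"
proof -
  define r where "r = {(x, y). \<exists>B\<in>A. x \<in> B \<and> y \<in> B}"
  have R: "{(x, y). \<exists>B\<in>(`) f ` A. x \<in> B \<and> y \<in> B} = map_prod f f ` r"
    unfolding r_def by force
  have fwd: "(f x, f y) \<in> (map_prod f f ` r)\<^sup>+" if "(x, y) \<in> r\<^sup>+" for x y
    using that
  proof induction
    case (step y z)
    have "(f y, f z) \<in> map_prod f f ` r"
      using step.hyps(2) by force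
    with step.IH show ?case
      by (rule trancl_into_trancl)
  qed force
  have bwd: "\<exists>y. v = f y \<and> (x, y) \<in> r\<^sup>+" if "(f x, v) \<in> (map_prod f f ` r)\<^sup>+" for x v
    using that
  proof induction
    case (base v)
    then show ?case
      using injD[OF assms] by force
  next
    case (step v w)
    then obtain y where y: "v = f y" "(x, y) \<in> r\<^sup>+"
      by blast
    from step.hyps(2) obtain y' z where z: "v = f y'" "w = f z" "(y', z) \<in> r"
      by auto
    with y have "y' = y"
      using injD[OF assms] by simp
    with y z show ?case
      by (blast intro: trancl_into_trancl)
  qed
  have cls: "(map_prod f f ` r)\<^sup>+ `` {f x} = f ` (r\<^sup>+ `` {x})" for x
    using fwd bwd by blast
  have quot: "components A' = (\<lambda>x. {(x, y). \<exists>B\<in>A'. x \<in> B \<and> y \<in> B}\<^sup>+ `` {x}) ` \<Union>A'"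
    for A' :: "'c set set"
    unfolding components_def quotient_def by blast
  have "components ((`) f ` A) = (\<lambda>x. (map_prod f f ` r)\<^sup>+ `` {x}) ` f ` \<Union>A"
    unfolding quot R image_Union ..
  also have "\<dots> = (`) f ` (\<lambda>x. r\<^sup>+ `` {x}) ` \<Union>A"
    by (simp only: image_image cls)
  also have "\<dots> = (`) f ` components A"
    unfolding quot r_def ..
  finally show ?thesis .
qed

lemma stack_components_relabel:
  assumes "\<sigma> permutes S"
  shows "stack_components (relabel \<sigma> p) (relabel \<sigma> q) = (`) (map_node \<sigma>) ` stack_components p q"
proof -
  have *: "upper_node (map_vertex \<sigma> x) = map_node \<sigma> (upper_node x)"
    "lower_node (map_vertex \<sigma> x) = map_node \<sigma> (lower_node x)" for x
    by (cases x; simp)+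
  have "(`) upper_node ` relabel \<sigma> q \<union> (`) lower_node ` relabel \<sigma> p
      = (`) (map_node \<sigma>) ` ((`) upper_node ` q \<union> (`) lower_node ` p)"
    by (simp add: relabel_def image_Un image_image *)
  then show ?thesis
    unfolding stack_components_def using components_image[of "map_node \<sigma>"]
    by (simp add: node.inj_map permutes_inj[OF assms])
qed

lemma compose_relabel:
  assumes "\<sigma> permutes S"
  shows "compose (relabel \<sigma> p) (relabel \<sigma> q) = relabel \<sigma> (compose p q)"
proof -
  have inj: "inj (map_node \<sigma>)"
    by (simp add: node.inj_map permutes_inj[OF assms])
  have eq: "outer_node (map_vertex \<sigma> x) = map_node \<sigma> (outer_node x)" for x
    by (cases x) simp_all
  have surj: "\<exists>y. x = map_vertex \<sigma> y" for x
    by (rule exI[of _ "map_vertex (inv \<sigma>) x"])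
      (simp add: vertex.map_comp permutes_inv_o[OF assms] vertex.map_id)
  have "outer_node -` (map_node \<sigma> ` C) = map_vertex \<sigma> ` (outer_node -` C)" for C
  proof (intro set_eqI iffI)
    fix x assume "x \<in> outer_node -` (map_node \<sigma> ` C)"
    then show "x \<in> map_vertex \<sigma> ` (outer_node -` C)"
      using surj[of x] by (auto simp: eq dest!: injD[OF inj])
  qed (auto simp: eq)
  then have "(\<lambda>C. outer_node -` C) ` stack_components (relabel \<sigma> p) (relabel \<sigma> q)
      = (`) (map_vertex \<sigma>) ` (\<lambda>C. outer_node -` C) ` stack_components p q"
    unfolding stack_components_relabel[OF assms] image_image by simp
  moreover have "(`) (map_vertex \<sigma>) ` X - {{}} = (`) (map_vertex \<sigma>) ` (X - {{}})" for X
    by auto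
  ultimately show ?thesis
    unfolding compose_def by (simp add: relabel_def)
qed

lemma kappa_relabel:
  assumes "\<sigma> permutes S"
  shows "kappa (relabel \<sigma> p) (relabel \<sigma> q) = kappa p q"
proof -
  have inj: "inj ((`) (map_node \<sigma>))"
    by (intro inj_image_set) (simp add: node.inj_map permutes_inj[OF assms])
  have "map_node \<sigma> x \<in> range Middle \<longleftrightarrow> x \<in> range Middle" for x
    by (cases x) auto
  then have "map_node \<sigma> ` C \<subseteq> range Middle \<longleftrightarrow> C \<subseteq> range Middle" for C
    unfolding image_subset_iff subset_eq[of C] by simp
  then have "{C \<in> stack_components (relabel \<sigma> p) (relabel \<sigma> q). C \<subseteq> range Middle}
      = (`) (map_node \<sigma>) ` {C \<in> stack_components p q. C \<subseteq> range Middle}"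
    unfolding stack_components_relabel[OF assms] by blast
  then show ?thesis
    unfolding kappa_def by (simp add: card_image inj_on_subset[OF inj])
qed

lemma join_eqI:
  assumes "refines (vertices k) p r" "refines (vertices k) p' r"
    "\<And>s. refines (vertices k) p s \<Longrightarrow> refines (vertices k) p' s \<Longrightarrow> refines (vertices k) r s"
  shows "join k p p' = r"
  unfolding join_def
proof (rule the_equality)
  fix s
  assume "refines (vertices k) p s \<and> refines (vertices k) p' s \<and>
    (\<forall>t. refines (vertices k) p t \<and> refines (vertices k) p' t \<longrightarrow> refines (vertices k) s t)"
  then have "refines (vertices k) s r" "refines (vertices k) r s"
    using assms by simp_all
  then show "s = r"
    by (rule refines_asym)
qed (use assms in simp)

lemma join_eq_components:
  assumes "p \<in> diagrams k" "p' \<in> diagrams k"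
  shows "join k p p' = components (p \<union> p')"
proof (rule join_eqI)
  let ?R = "{(x, y). \<exists>B\<in>p \<union> p'. x \<in> B \<and> y \<in> B}"
  let ?V = "vertices k"
  have part: "partition_on ?V p" "partition_on ?V p'"
    using assms by (auto simp: diagrams_def)
  then have V: "\<Union>(p \<union> p') = ?V"
    by (auto dest: partition_onD1)
  have sub: "?R \<subseteq> ?V \<times> ?V"
    using V by blast
  have eq: "equiv ?V (?R\<^sup>+)"
  proof (rule equivI)
    show "?R\<^sup>+ \<subseteq> ?V \<times> ?V"
      by (rule trancl_subset_Sigma[OF sub])
    show "refl_on ?V (?R\<^sup>+)"
      by (rule refl_onI) (use V in blast)
    show "sym (?R\<^sup>+)"
      by (rule sym_trancl) (auto simp: sym_def)
  qed simp
  have comps: "components (p \<union> p') = ?V // ?R\<^sup>+"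
    unfolding components_def V ..
  have partC: "partition_on ?V (components (p \<union> p'))"
    unfolding comps by (rule partition_on_quotient[OF eq])
  have sup: "\<exists>Y\<in>components (p \<union> p'). B \<subseteq> Y" if "B \<in> p \<union> p'" for B
  proof -
    have "B \<noteq> {}"
      using that partition_onD3[OF part(1)] partition_onD3[OF part(2)] by blast
    then obtain x where x: "x \<in> B"
      by blast
    then have "B \<subseteq> ?R\<^sup>+ `` {x}"
      using that by (auto intro!: r_into_trancl)
    moreover have "?R\<^sup>+ `` {x} \<in> ?V // ?R\<^sup>+"
      using x that V by (intro quotientI) blast
    ultimately show ?thesis
      unfolding comps by blast
  qed
  show "refines ?V p (components (p \<union> p'))" "refines ?V p' (components (p \<union> p'))"
    unfolding refines_def using part partC sup by blast+
  fix s assume s: "refines ?V p s" "refines ?V p' s"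
  have sD: "partition_on ?V s"
    using s by (simp add: refines_def)
  have sub_s: "\<exists>Y\<in>s. B \<subseteq> Y" if "B \<in> p \<union> p'" for B
    using s that unfolding refines_def by auto
  have edge: "\<exists>Y\<in>s. x \<in> Y \<and> y \<in> Y" if xy: "(x, y) \<in> ?R" for x y
  proof -
    obtain B where "B \<in> p \<union> p'" "x \<in> B" "y \<in> B"
      using xy by blast
    then show ?thesis
      using sub_s[of B] by blast
  qed
  have step: "\<exists>Y\<in>s. x \<in> Y \<and> y \<in> Y" if "(x, y) \<in> ?R\<^sup>+" for x y
    using that
  proof induction
    case (base y)
    then show ?case by (rule edge)
  next
    case (step y z)
    obtain Y where Y: "Y \<in> s" "x \<in> Y" "y \<in> Y"
      using step.IH by blast
    obtain Z where Z: "Z \<in> s" "y \<in> Z" "z \<in> Z"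
      using edge[OF step.hyps(2)] by blast
    have "Y = Z"
      using Y Z disjointD[OF partition_onD2[OF sD], of Y Z] by blast
    with Y Z show ?case
      by blast
  qed
  show "refines ?V (components (p \<union> p')) s"
    unfolding refines_def
  proof (intro conjI ballI partC sD)
    fix C assume "C \<in> components (p \<union> p')"
    then obtain x where x: "x \<in> ?V" "C = ?R\<^sup>+ `` {x}"
      unfolding comps by (auto elim: quotientE)
    then obtain Y where Y: "Y \<in> s" "x \<in> Y"
      using partition_onD1[OF sD] by blast
    have "C \<subseteq> Y"
    proof
      fix y assume "y \<in> C"
      then obtain Z where "Z \<in> s" "x \<in> Z" "y \<in> Z"
        using step x by blast
      then show "y \<in> Y"
        using Y disjointD[OF partition_onD2[OF sD], of Y Z] by blast
    qed
    then show "\<exists>Y\<in>s. C \<subseteq> Y"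
      using Y by blast
  qed
qed

lemma join_relabel:
  assumes "\<sigma> permutes {1..k}" "p \<in> diagrams k" "q \<in> diagrams k"
  shows "join k (relabel \<sigma> p) (relabel \<sigma> q) = relabel \<sigma> (join k p q)"
  using assms components_image[OF inj_map_vertex[OF assms(1)], of "p \<union> q"]
  by (simp add: join_eq_components relabel_diagrams) (simp add: relabel_def image_Un)

lemma id_diagram_diagrams: "id_diagram k \<in> diagrams k"
proof -
  have id: "id_diagram k = (\<lambda>i. {Top i, Bottom i}) ` {1..k}"
    unfolding id_diagram_def by blast
  have "partition_on (vertices k) (id_diagram k)"
  proof (rule partition_onI)
    show "\<Union>(id_diagram k) = vertices k"
      unfolding id vertices_def by blast
  qed (auto simp: id disjnt_def)
  then show ?thesis
    by (simp add: diagrams_def)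
qed

lemma dist_relabel:
  assumes "\<sigma> permutes {1..k}" "p \<in> diagrams k"
  shows "dist_diagram k (id_diagram k) (relabel \<sigma> p) = dist_diagram k (id_diagram k) p"
  using join_relabel[OF assms(1) id_diagram_diagrams assms(2)]
  by (simp add: dist_diagram_def nc_relabel[OF assms(1)] relabel_id_diagram[OF assms(1)])

lemma factorizations_relabel_sub:
  assumes "\<sigma> permutes {1..k}" "p \<in> diagrams k" "(p1, p2) \<in> factorizations k p"
  shows "(relabel \<sigma> p1, relabel \<sigma> p2) \<in> factorizations k (relabel \<sigma> p)"
  using assms
  by (auto simp: factorizations_def kreweras_def compose_relabel[OF assms(1)] relabel_diagrams
      dist_relabel nc_relabel[OF assms(1)] kappa_relabel[OF assms(1)])

lemma factorizations_relabel:
  assumes "\<sigma> permutes {1..k}" "p \<in> diagrams k"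
  shows "factorizations k (relabel \<sigma> p) = map_prod (relabel \<sigma>) (relabel \<sigma>) ` factorizations k p"
proof (intro set_eqI iffI)
  fix x assume "x \<in> factorizations k (relabel \<sigma> p)"
  then have "(relabel (inv \<sigma>) (fst x), relabel (inv \<sigma>) (snd x)) \<in> factorizations k p"
    using factorizations_relabel_sub[OF permutes_inv[OF assms(1)], of "relabel \<sigma> p" "fst x" "snd x"]
    by (simp only: relabel_diagrams[OF assms] relabel_inv[OF assms(1)] prod.collapse)
  moreover have "x = map_prod (relabel \<sigma>) (relabel \<sigma>)
      (relabel (inv \<sigma>) (fst x), relabel (inv \<sigma>) (snd x))"
    by (simp add: relabel_inv'[OF assms(1)])
  ultimately show "x \<in> map_prod (relabel \<sigma>) (relabel \<sigma>) ` factorizations k p"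
    by (rule rev_image_eqI)
qed (use factorizations_relabel_sub assms in auto)

lemma juxtapose_diagrams:
  assumes "p \<in> diagrams k" "q \<in> diagrams l"
  shows "juxtapose k p q \<in> diagrams (k + l)"
proof -
  have eq: "vertices (k + l) = vertices k \<union> map_vertex ((+) k) ` vertices l"
  proof -
    have "(+) k ` {1..l} = {k + 1..k + l}"
      by (simp add: image_add_atLeastAtMost)
    then have "{1..k + l} = {1..k} \<union> (+) k ` {1..l}"
      by auto
    moreover have "map_vertex ((+) k) ` vertices l = Top ` (+) k ` {1..l} \<union> Bottom ` (+) k ` {1..l}"
      unfolding vertices_def image_Un image_image by (simp only: vertex.map)
    ultimately show ?thesis
      unfolding vertices_def[of k] vertices_def[of "k + l"] by (simp only: image_Un) blast
  qed
  have "partition_on (map_vertex ((+) k) ` vertices l) (relabel ((+) k) q)"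
    using assms by (intro relabel_partition_on) (auto simp: diagrams_def)
  moreover have "vertices k \<inter> map_vertex ((+) k) ` vertices l = {}"
    by (auto simp: vertices_def)
  moreover have "partition_on (vertices k) p"
    using assms(1) by (simp add: diagrams_def)
  ultimately have "partition_on (vertices k \<union> map_vertex ((+) k) ` vertices l)
      (p \<union> relabel ((+) k) q)"
    unfolding partition_on_def using disjoint_union[of p "relabel ((+) k) q"] by simp
  then show ?thesis
    unfolding diagrams_def juxtapose_def eq by simp
qed

lemma juxtapose_relabel:
  assumes "\<sigma> permutes {1..k}" "\<tau> permutes {1..l}" "p \<in> diagrams k" "q \<in> diagrams l"
  shows "\<exists>\<rho>. \<rho> permutes {1..k + l} \<and>
    juxtapose k (relabel \<sigma> p) (relabel \<tau> q) = relabel \<rho> (juxtapose k p q)"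
proof -
  define \<rho> where "\<rho> = (\<lambda>i. if i \<le> k then \<sigma> i else k + \<tau> (i - k))"
  have s: "\<sigma> i \<in> {1..k} \<longleftrightarrow> i \<in> {1..k}" for i
    by (rule permutes_in_image[OF assms(1)])
  have t: "\<tau> i \<in> {1..l} \<longleftrightarrow> i \<in> {1..l}" for i
    by (rule permutes_in_image[OF assms(2)])
  have s0: "\<sigma> 0 = 0" and t0: "\<tau> 0 = 0"
    using assms(1,2) by (auto simp: permutes_def)
  have sk: "\<sigma> i \<le> k" if "i \<le> k" for i
    using s[of i] s0 that by (cases "i = 0") auto
  have tp: "\<tau> i > 0" if "i > 0" for i
    using permutes_inj[OF assms(2)] t0 that by (metis gr0I injD less_numeral_extra(3))
  have "\<rho> permutes {1..k + l}"
  proof (rule bij_imp_permutes)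
    have inj: "inj_on \<rho> {1..k + l}"
    proof (rule inj_onI)
      fix i j assume "\<rho> i = \<rho> j"
      then show "i = j"
        using permutes_inj[OF assms(1)] permutes_inj[OF assms(2)] sk[of i] sk[of j]
          tp[of "i - k"] tp[of "j - k"]
        by (auto simp: \<rho>_def inj_eq split: if_splits)
    qed
    have "\<rho> ` {1..k + l} \<subseteq> {1..k + l}"
    proof
      fix y assume "y \<in> \<rho> ` {1..k + l}"
      then obtain i where i: "i \<in> {1..k + l}" "y = \<rho> i" by blast
      show "y \<in> {1..k + l}"
      proof (cases "i \<le> k")
        case True
        then show ?thesis using s[of i] i by (auto simp: \<rho>_def)
      next
        case False
        then show ?thesis using t[of "i - k"] i by (auto simp: \<rho>_def)
      qed
    qed
    with inj show "bij_betw \<rho> {1..k + l} {1..k + l}"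
      by (simp add: bij_betw_def endo_inj_surj)
    fix i assume i: "i \<notin> {1..k + l}"
    then have "\<tau> (i - k) = i - k" if "i > k"
      using that i by (intro permutes_not_in[OF assms(2)]) auto
    with i show "\<rho> i = i"
      using s0 by (cases "i = 0") (auto simp: \<rho>_def)
  qed
  moreover have "relabel \<rho> p = relabel \<sigma> p"
  proof -
    have "map_vertex \<rho> x = map_vertex \<sigma> x" if "x \<in> vertices k" for x
      using that by (auto simp: vertices_def \<rho>_def)
    then have "map_vertex \<rho> ` B = map_vertex \<sigma> ` B" if "B \<in> p" for B
      using that assms(3) by (intro image_cong) (auto simp: diagrams_def dest: partition_onD1)
    then show ?thesis
      unfolding relabel_def by (rule image_cong[OF refl])
  qed
  moreover have "relabel \<rho> (relabel ((+) k) q) = relabel ((+) k) (relabel \<tau> q)"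
  proof -
    have "map_vertex \<rho> (map_vertex ((+) k) x) = map_vertex ((+) k) (map_vertex \<tau> x)"
      if "x \<in> vertices l" for x
      using that by (auto simp: vertices_def \<rho>_def)
    then have "map_vertex \<rho> ` map_vertex ((+) k) ` B = map_vertex ((+) k) ` map_vertex \<tau> ` B"
      if "B \<in> q" for B
      using that assms(4) unfolding image_image
      by (intro image_cong) (auto simp: diagrams_def dest: partition_onD1)
    then show ?thesis
      unfolding relabel_def image_image by (rule image_cong[OF refl])
  qed
  ultimately show ?thesis
    by (intro exI[of _ \<rho>]) (simp add: juxtapose_def relabel_def image_Un)
qed

lemma part_equivp_conj_rel: "part_equivp conj_rel"
proof (rule part_equivpI)
  have "conj_rel (0, id_diagram 0) (0, id_diagram 0)"
    using id_diagram_diagrams permutes_id by (auto simp: conj_rel_def intro!: exI[of _ id])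
  then show "\<exists>x. conj_rel x x" ..
  show "symp conj_rel"
  proof (rule sympI)
    fix x y assume "conj_rel x y"
    then obtain \<sigma> where "fst x = fst y" "snd x \<in> diagrams (fst x)" "\<sigma> permutes {1..fst x}"
      "snd y = relabel \<sigma> (snd x)"
      by (auto simp: conj_rel_iff)
    then show "conj_rel y x"
      unfolding conj_rel_iff
      by (auto simp: relabel_diagrams relabel_inv intro!: exI[of _ "inv \<sigma>"] permutes_inv)
  qed
  show "transp conj_rel"
  proof (rule transpI)
    fix x y z assume "conj_rel x y" "conj_rel y z"
    then obtain \<sigma> \<tau> where "fst x = fst y" "fst y = fst z" "snd x \<in> diagrams (fst x)"
      "\<sigma> permutes {1..fst x}" "\<tau> permutes {1..fst y}"
      "snd y = relabel \<sigma> (snd x)" "snd z = relabel \<tau> (snd y)"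
      by (auto simp: conj_rel_iff)
    then show "conj_rel x z"
      unfolding conj_rel_iff
      by (auto simp: relabel_relabel intro!: exI[of _ "\<tau> \<circ> \<sigma>"] permutes_compose)
  qed
qed

subsection \<open>The bialgebra of orbits\<close>

quotient_type orbit = "nat \<times> diagram" / partial: conj_rel
  by (rule part_equivp_conj_rel)

definition orbit_of :: "nat \<Rightarrow> diagram \<Rightarrow> orbit" where
  "orbit_of k p = abs_orbit (k, p)"

lemma orbit_of_eq_iff:
  assumes "p \<in> diagrams k" "q \<in> diagrams l"
  shows "orbit_of k p = orbit_of l q \<longleftrightarrow>
    k = l \<and> (\<exists>\<sigma>. \<sigma> permutes {1..k} \<and> q = relabel \<sigma> p)"
proof -
  have refl: "conj_rel (m, r) (m, r)" if "r \<in> diagrams m" for m r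
    using that by (auto simp: conj_rel_def intro!: exI[of _ id] permutes_id)
  show ?thesis
    unfolding orbit_of_def using Quotient_rel[OF Quotient_orbit, of "(k, p)" "(l, q)"] refl assms
    by (auto simp: conj_rel_def)
qed

lift_definition orbit_tensor :: "orbit \<Rightarrow> orbit \<Rightarrow> orbit" is
  "\<lambda>(k, p) (l, q). (k + l, juxtapose k p q)"
  unfolding conj_rel_iff
  using juxtapose_diagrams juxtapose_relabel by (auto split: prod.splits)

lift_definition orbit_comult :: "orbit \<Rightarrow> (orbit \<times> orbit) \<Rightarrow>\<^sub>0 complex" is
  "\<lambda>(k, p). \<Sum>(p1, p2)\<in>factorizations k p. basis (orbit_of k p1) \<otimes>\<^sub>t basis (orbit_of k p2)"
proof clarify
  fix k p l q
  assume "conj_rel (k, p) (l, q)"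
  then obtain \<sigma> where \<sigma>: "\<sigma> permutes {1..k}" and p: "p \<in> diagrams k" and q: "l = k" "q = relabel \<sigma> p"
    unfolding conj_rel_def prod.case by metis
  have inj: "inj (relabel \<sigma>)"
    by (rule inj_on_inverseI[of _ "relabel (inv \<sigma>)"]) (rule relabel_inv[OF \<sigma>])
  have orb: "orbit_of k (relabel \<sigma> r) = orbit_of k r" if "r \<in> diagrams k" for r
    using orbit_of_eq_iff[of r k "relabel \<sigma> r" k] that \<sigma> relabel_diagrams by auto
  have "(\<Sum>(p1, p2)\<in>factorizations l q. basis (orbit_of l p1) \<otimes>\<^sub>t basis (orbit_of l p2))
      = (\<Sum>(p1, p2)\<in>factorizations k p.
          basis (orbit_of k (relabel \<sigma> p1)) \<otimes>\<^sub>t basis (orbit_of k (relabel \<sigma> p2)))"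
    unfolding q factorizations_relabel[OF \<sigma> p]
    by (subst sum.reindex) (auto simp: case_prod_unfold intro!: inj_on_subset[OF prod.inj_map[OF inj inj]])
  also have "\<dots> = (\<Sum>(p1, p2)\<in>factorizations k p. basis (orbit_of k p1) \<otimes>\<^sub>t basis (orbit_of k p2))"
    by (intro sum.cong) (auto simp: factorizations_def orb)
  finally show "(\<Sum>(p1, p2)\<in>factorizations k p. basis (orbit_of k p1) \<otimes>\<^sub>t basis (orbit_of k p2))
      = (\<Sum>(p1, p2)\<in>factorizations l q. basis (orbit_of l p1) \<otimes>\<^sub>t basis (orbit_of l p2))" ..
qed

type_synonym orbit_space = "orbit \<Rightarrow>\<^sub>0 complex"

definition box_mult :: "orbit_space \<Rightarrow> orbit_space \<Rightarrow> orbit_space" where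
  "box_mult = bilin_ext (\<lambda>x y. basis (orbit_tensor x y))"

definition box_unit :: orbit_space where
  "box_unit = basis (orbit_of 0 {})"

definition box_comult :: "orbit_space \<Rightarrow> ((orbit \<times> orbit) \<Rightarrow>\<^sub>0 complex)" where
  "box_comult = lin_ext scale orbit_comult"

definition box_counit :: "orbit_space \<Rightarrow> complex" where
  "box_counit = lin_ext (*) (\<lambda>x. if \<exists>k. x = orbit_of k (id_diagram k) then 1 else 0)"

lemma conj_rel_refl: "p \<in> diagrams k \<Longrightarrow> conj_rel (k, p) (k, p)"
  by (auto simp: conj_rel_def intro!: exI[of _ id] permutes_id)

lemma orbit_cases:
  obtains k p where "p \<in> diagrams k" "x = orbit_of k p"
proof -
  obtain y where y: "conj_rel y y" "x = abs_orbit y"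
    using Quotient_abs_rep[OF Quotient_orbit, of x] Quotient_rep_reflp[OF Quotient_orbit, of x] by metis
  have "snd y \<in> diagrams (fst y)" "x = orbit_of (fst y) (snd y)"
    using y by (simp_all add: conj_rel_iff orbit_of_def)
  then show thesis
    by (rule that)
qed

lemma box_mult_orbits:
  assumes "p \<in> diagrams k" "q \<in> diagrams l"
  shows "box_mult (basis (orbit_of k p)) (basis (orbit_of l q)) =
    basis (orbit_of (k + l) (juxtapose k p q))"
  using orbit_tensor.abs_eq[OF conj_rel_refl[OF assms(1)] conj_rel_refl[OF assms(2)]]
  by (simp add: box_mult_def bilin_ext_basis orbit_of_def)

lemma box_comult_orbit:
  assumes "p \<in> diagrams k"
  shows "box_comult (basis (orbit_of k p)) =
    (\<Sum>(p1, p2)\<in>factorizations k p. basis (orbit_of k p1) \<otimes>\<^sub>t basis (orbit_of k p2))"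
  using orbit_comult.abs_eq[OF conj_rel_refl[OF assms]]
  by (simp add: box_comult_def lin_ext_basis vector_space_scale orbit_of_def)

lemma box_counit_orbit:
  assumes "p \<in> diagrams k"
  shows "box_counit (basis (orbit_of k p)) = (if p = id_diagram k then 1 else 0)"
proof -
  have "(\<exists>l. orbit_of k p = orbit_of l (id_diagram l)) \<longleftrightarrow> p = id_diagram k"
  proof
    assume "\<exists>l. orbit_of k p = orbit_of l (id_diagram l)"
    then obtain l where "orbit_of l (id_diagram l) = orbit_of k p" by metis
    then obtain \<sigma> where "l = k" "\<sigma> permutes {1..l}" "p = relabel \<sigma> (id_diagram l)"
      using orbit_of_eq_iff[OF id_diagram_diagrams assms] by blast
    then show "p = id_diagram k"
      by (simp add: relabel_id_diagram)
  qed blast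
  then show ?thesis
    by (simp add: box_counit_def lin_ext_basis vector_space_complex)
qed

end

theory Submission
  imports Defs
begin

text \<open>
  Write \<open>f(p) = nc(p) - nc(p \<or> id)\<close>. The condition that \<open>p2\<close> lies in the Kreweras complement
  unfolds to \<open>\<delta>(p1, p2) = 0\<close> for the defect \<open>\<delta>(p1, p2) = f(p1) + f(p2) - f(p1 \<circ> p2) - \<kappa>(p1, p2)\<close>.
  Counting the components of the four-row graph of three diagrams in two ways shows that \<open>\<kappa>\<close>,
  hence \<open>\<delta>\<close>, is a 2-cocycle. Moreover \<open>\<delta> \<ge> 0\<close>: the three-row graph of \<open>p1\<close> and \<open>p2\<close> has
  \<open>nc(p1 \<circ> p2) + \<kappa>(p1, p2)\<close> components; joining the rows by vertical edges removes at most
  \<open>f(p1) + f(p2)\<close> of them by submodularity, and leaves at most \<open>nc((p1 \<circ> p2) \<or> id)\<close>.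
  Coassociativity follows, since a sum of two nonnegative defects vanishes iff both do. If
  \<open>\<delta>(p1, p2) = 0\<close>, the last bound is an equality, so any two indices linked by \<open>p1\<close> or \<open>p2\<close> are
  linked by \<open>(p1 \<circ> p2) \<or> id\<close>; hence every factorization of a juxtaposition is itself a
  juxtaposition, which makes the coproduct multiplicative.
\<close>

subsection \<open>Connected components\<close>

text \<open>This names the relation whose classes form \<open>components A\<close>, so that
  arguments can pass between chains of edges and classes. The closure is not reflexive: a point
  outside \<open>\<Union>A\<close> is related to nothing, and \<open>conn A\<close> is an
  equivalence on \<open>\<Union>A\<close> only.\<close>

definition conn :: "'a set set \<Rightarrow> 'a rel" where
  "conn A = {(x, y). \<exists>B\<in>A. x \<in> B \<and> y \<in> B}\<^sup>+"

lemma conn_edge: "B \<in> A \<Longrightarrow> x \<in> B \<Longrightarrow> y \<in> B \<Longrightarrow> (x, y) \<in> conn A"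
  unfolding conn_def by (rule r_into_trancl) blast

lemma conn_trans: "(x, y) \<in> conn A \<Longrightarrow> (y, z) \<in> conn A \<Longrightarrow> (x, z) \<in> conn A"
  unfolding conn_def by (rule trancl_trans)

text \<open>Induction along a chain of edges, in a form that serves three purposes: comparing two
  graphs (\<open>f\<close> the identity), contracting a row of vertices (\<open>f\<close> the
  contraction), and showing that a property is constant on components (\<open>f\<close> the
  property, \<open>r\<close> equal to \<open>Id\<close>).\<close>

lemma conn_map:
  assumes "(x, y) \<in> conn A" "trans r"
    and "\<And>B x y. B \<in> A \<Longrightarrow> x \<in> B \<Longrightarrow> y \<in> B \<Longrightarrow> (f x, f y) \<in> r"
  shows "(f x, f y) \<in> r"
  using assms(1) unfolding conn_def
proof induction
  case (base y)
  then show ?case using assms(3) by blast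
next
  case (step y z)
  then have "(f y, f z) \<in> r" using assms(3) by blast
  with step.IH show ?case using assms(2) by (blast dest: transD)
qed

lemma trans_conn [simp]: "trans (conn A)"
  by (simp add: conn_def)

lemma sym_conn: "sym (conn A)"
  unfolding conn_def by (rule sym_trancl) (auto simp: sym_def)

lemma conn_sym: "(x, y) \<in> conn A \<Longrightarrow> (y, x) \<in> conn A"
  using sym_conn by (rule symD)

lemma conn_minimal:
  assumes "\<And>B x y. B \<in> A \<Longrightarrow> x \<in> B \<Longrightarrow> y \<in> B \<Longrightarrow> (x, y) \<in> conn A'"
  shows "conn A \<subseteq> conn A'"
  using conn_map[of _ _ A "conn A'" "\<lambda>x. x"] assms by auto

lemma conn_mono: "A \<subseteq> A' \<Longrightarrow> conn A \<subseteq> conn A'"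
  by (rule conn_minimal) (blast intro: conn_edge)

lemma conn_subset: "conn A \<subseteq> \<Union>A \<times> \<Union>A"
  unfolding conn_def by (rule trancl_subset_Sigma) blast

lemma conn_refl: "x \<in> \<Union>A \<Longrightarrow> (x, x) \<in> conn A"
  by (blast intro: conn_edge)

lemma equiv_conn: "equiv (\<Union>A) (conn A)"
  by (intro equivI conn_subset sym_conn trans_conn refl_onI conn_refl)

lemma conn_class_eq: "(x, y) \<in> conn A \<Longrightarrow> conn A `` {x} = conn A `` {y}"
  using equiv_conn by (rule equiv_class_eq)

lemma components_conn: "components A = \<Union>A // conn A"
  by (simp add: components_def conn_def)

lemma partition_on_components: "partition_on (\<Union>A) (components A)"
  unfolding components_conn by (rule partition_on_quotient[OF equiv_conn])

lemma Union_components [simp]: "\<Union>(components A) = \<Union>A"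
  using partition_onD1[OF partition_on_components] by (rule sym)

lemma in_components_iff: "C \<in> components A \<longleftrightarrow> (\<exists>x\<in>\<Union>A. C = conn A `` {x})"
  unfolding components_conn by (auto simp: quotient_def)

lemma class_in_components: "x \<in> \<Union>A \<Longrightarrow> conn A `` {x} \<in> components A"
  by (auto simp: in_components_iff)

lemma conn_iff_components: "(x, y) \<in> conn A \<longleftrightarrow> (\<exists>C\<in>components A. x \<in> C \<and> y \<in> C)"
proof
  assume xy: "(x, y) \<in> conn A"
  then have "x \<in> \<Union>A"
    using conn_subset[of A] by blast
  with xy show "\<exists>C\<in>components A. x \<in> C \<and> y \<in> C"
    using conn_refl[of x A] by (intro bexI[of _ "conn A `` {x}"] class_in_components) auto
qed (auto simp: in_components_iff intro: conn_trans[OF conn_sym])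

lemma component_eq_class: "C \<in> components A \<Longrightarrow> x \<in> C \<Longrightarrow> C = conn A `` {x}"
  using conn_class_eq by (fastforce simp: in_components_iff)

section \<open>Partitions determined by their same-block relation\<close>

lemma partition_on_subset_eq:
  assumes P: "partition_on V P" and Q: "partition_on W Q"
    and eq: "\<And>x y. (\<exists>B\<in>P. x \<in> B \<and> y \<in> B) \<longleftrightarrow> (\<exists>B\<in>Q. x \<in> B \<and> y \<in> B)"
  shows "P \<subseteq> Q"
proof
  fix B assume B: "B \<in> P"
  then have "B \<noteq> {}"
    using partition_onD3[OF P] by blast
  then obtain x where x: "x \<in> B" by blast
  then obtain C where C: "C \<in> Q" "x \<in> C"
    using eq B by blast
  have "y \<in> B \<longleftrightarrow> y \<in> C" for y
  proof
    assume "y \<in> B"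
    then obtain D where "D \<in> Q" "x \<in> D" "y \<in> D" using eq B x by blast
    then show "y \<in> C" using C disjointD[OF partition_onD2[OF Q], of C D] by blast
  next
    assume "y \<in> C"
    then obtain D where "D \<in> P" "x \<in> D" "y \<in> D" using eq C by blast
    then show "y \<in> B" using B x disjointD[OF partition_onD2[OF P], of B D] by blast
  qed
  then have "B = C" by blast
  with C show "B \<in> Q" by simp
qed

text \<open>A block is recovered from any of its points as the set of points sharing a block with
  it, so the same-block relation determines the partition. The ground sets \<open>V\<close> and
  \<open>W\<close> are kept apart so that their equality need not be known beforehand.\<close>

lemma partition_on_eqI:
  assumes "partition_on V P" "partition_on W Q"
    and "\<And>x y. (\<exists>B\<in>P. x \<in> B \<and> y \<in> B) \<longleftrightarrow> (\<exists>B\<in>Q. x \<in> B \<and> y \<in> B)"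
  shows "P = Q"
  using partition_on_subset_eq[OF assms(1,2)] partition_on_subset_eq[OF assms(2,1)] assms(3)
  by (intro equalityI) simp_all

text \<open>Blocks of a partition that share a vertex coincide, so a chain of edges never leaves its
  first block.\<close>

lemma conn_partition:
  assumes "partition_on V P"
  shows "(x, y) \<in> conn P \<longleftrightarrow> (\<exists>B\<in>P. x \<in> B \<and> y \<in> B)"
proof
  assume "(x, y) \<in> conn P"
  then show "\<exists>B\<in>P. x \<in> B \<and> y \<in> B"
    unfolding conn_def
  proof induction
    case (step y z)
    then obtain B C where "B \<in> P" "x \<in> B" "y \<in> B" "C \<in> P" "y \<in> C" "z \<in> C" by blast
    then show ?case
      using disjointD[OF partition_onD2[OF assms], of B C] by blast
  qed blast
qed (blast intro: conn_edge)

lemma components_partition: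
  assumes "partition_on V P" shows "components P = P"
  by (rule partition_on_eqI[OF partition_on_components assms])
    (simp add: conn_partition[OF assms] flip: conn_iff_components)

lemma components_disjoint_Un:
  assumes "\<Union>A \<inter> \<Union>B = {}"
  shows "components (A \<union> B) = components A \<union> components B"
proof (rule partition_on_eqI[OF partition_on_components])
  let ?P = "components A \<union> components B"
  show part: "partition_on (\<Union>?P) ?P"
    using partition_on_components[of A] partition_on_components[of B] assms
    unfolding partition_on_def by (simp add: disjoint_union)
  have "conn (A \<union> B) = conn ?P"
  proof (rule equalityI; rule conn_minimal)
    fix C x y assume *: "C \<in> A \<union> B" "x \<in> C" "y \<in> C"
    then have "(x, y) \<in> conn A \<or> (x, y) \<in> conn B" by (blast intro: conn_edge)
    then show "(x, y) \<in> conn ?P"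
      unfolding conn_iff_components[of x y A] conn_iff_components[of x y B]
      by (blast intro: conn_edge)
  next
    fix C x y assume "C \<in> ?P" "x \<in> C" "y \<in> C"
    then have "(x, y) \<in> conn A \<or> (x, y) \<in> conn B"
      unfolding conn_iff_components by blast
    then show "(x, y) \<in> conn (A \<union> B)"
      using conn_mono[of A "A \<union> B"] conn_mono[of B "A \<union> B"] by blast
  qed
  then show "(\<exists>C\<in>components (A \<union> B). x \<in> C \<and> y \<in> C) \<longleftrightarrow> (\<exists>C\<in>?P. x \<in> C \<and> y \<in> C)" for x y
    by (simp only: conn_partition[OF part] flip: conn_iff_components)
qed

section \<open>The number of components when edges are added\<close>

lemma finite_components: "finite (\<Union>A) \<Longrightarrow> finite (components A)"
  using finite_UnionD[of "components A"] by simp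

text \<open>The new edge fuses the classes of its endpoints and leaves all others alone. The formula
  also covers endpoints that were already connected: the removed classes and the inserted union are
  then one and the same set.\<close>

lemma components_insert_edge:
  assumes "x \<in> \<Union>A" "y \<in> \<Union>A"
  shows "components (insert {x, y} A) =
    insert (conn A `` {x} \<union> conn A `` {y}) (components A - {conn A `` {x}, conn A `` {y}})"
    (is "_ = ?P")
proof (rule partition_on_eqI[OF partition_on_components])
  let ?K = "conn A `` {x} \<union> conn A `` {y}"
  show part: "partition_on (\<Union>?P) ?P"
  proof (rule partition_onI)
    fix B C assume *: "B \<in> ?P" "C \<in> ?P" "B \<noteq> C"
    have d: "disjnt ?K C" if "C \<in> components A" "C \<noteq> conn A `` {x}" "C \<noteq> conn A `` {y}" for C
    proof -
      have "z \<notin> ?K" if z: "z \<in> C" for z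
      proof
        assume "z \<in> ?K"
        then have "conn A `` {x} = conn A `` {z} \<or> conn A `` {y} = conn A `` {z}"
          using component_eq_class[OF class_in_components[OF assms(1)], of z]
            component_eq_class[OF class_in_components[OF assms(2)], of z] by blast
        then show False
          using component_eq_class[OF \<open>C \<in> components A\<close> z] \<open>C \<noteq> conn A `` {x}\<close> \<open>C \<noteq> conn A `` {y}\<close> by simp
      qed
      then show ?thesis unfolding disjnt_def by blast
    qed
    have e: "disjnt B C" if "C \<in> components A" "B \<in> components A" "B \<noteq> C"
      using that partition_onD2[OF partition_on_components[of A]]
      by (auto simp: disjnt_def dest: disjointD)
    show "disjnt B C"
    proof (cases "B = ?K")
      case True
      with * have "C \<in> components A" "C \<noteq> conn A `` {x}" "C \<noteq> conn A `` {y}" by simp_all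
      then show ?thesis unfolding True by (rule d)
    next
      case False
      with * have B: "B \<in> components A" "B \<noteq> conn A `` {x}" "B \<noteq> conn A `` {y}" by simp_all
      show ?thesis
      proof (cases "C = ?K")
        case True
        show ?thesis unfolding True by (rule disjnt_sym[OF d[OF B]])
      next
        case False
        with * have "C \<in> components A" by simp
        then show ?thesis using B(1) *(3) by (rule e)
      qed
    qed
  next
    show "{} \<notin> ?P"
      using partition_onD3[OF partition_on_components[of A]] conn_refl[OF assms(1)] by blast
  qed (rule refl)
  have "conn (insert {x, y} A) = conn ?P"
  proof (rule equalityI; rule conn_minimal)
    fix C u v assume *: "C \<in> insert {x, y} A" "u \<in> C" "v \<in> C"
    show "(u, v) \<in> conn ?P"
    proof (cases "C \<in> A")
      case True
      then have "(u, v) \<in> conn A" using * by (blast intro: conn_edge)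
      then obtain D where D: "D \<in> components A" "u \<in> D" "v \<in> D"
        unfolding conn_iff_components by blast
      show ?thesis
      proof (cases "D \<in> {conn A `` {x}, conn A `` {y}}")
        case True
        then have "u \<in> ?K" "v \<in> ?K" using D(2,3) by auto
        then show ?thesis using conn_edge[of ?K ?P u v] by simp
      next
        case False
        then have "D \<in> ?P" using D(1) by simp
        then show ?thesis using D(2,3) by (rule conn_edge)
      qed
    next
      case False
      then have "u \<in> ?K" "v \<in> ?K"
        using * conn_refl[OF assms(1)] conn_refl[OF assms(2)] by auto
      then show ?thesis using conn_edge[of ?K ?P u v] by simp
    qed
  next
    fix C u v assume *: "C \<in> ?P" "u \<in> C" "v \<in> C"
    have m: "conn A \<subseteq> conn (insert {x, y} A)" by (rule conn_mono) blast
    have xy: "(x, y) \<in> conn (insert {x, y} A)" by (rule conn_edge[of "{x, y}"]) auto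
    show "(u, v) \<in> conn (insert {x, y} A)"
    proof (cases "C = ?K")
      case True
      then have "(x, u) \<in> conn (insert {x, y} A)" "(x, v) \<in> conn (insert {x, y} A)"
        using * m conn_trans[OF xy] by blast+
      then show ?thesis by (rule conn_trans[OF conn_sym])
    next
      case False
      then have "(u, v) \<in> conn A" using * unfolding conn_iff_components by blast
      then show ?thesis using m by blast
    qed
  qed
  then show "(\<exists>C\<in>components (insert {x, y} A). u \<in> C \<and> v \<in> C) \<longleftrightarrow> (\<exists>C\<in>?P. u \<in> C \<and> v \<in> C)" for u v
    by (simp only: conn_partition[OF part] flip: conn_iff_components)
qed

lemma card_components_insert_edge:
  assumes "finite (\<Union>A)" "x \<in> \<Union>A" "y \<in> \<Union>A"
  shows "card (components A) =
    card (components (insert {x, y} A)) + (if (x, y) \<in> conn A then 0 else 1)"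
proof -
  let ?X = "conn A `` {x}" and ?Y = "conn A `` {y}"
  have in_comps: "?X \<in> components A" "?Y \<in> components A"
    using assms by (auto intro: class_in_components)
  have eq: "?X = ?Y \<longleftrightarrow> (x, y) \<in> conn A"
    using assms conn_refl[of y A] conn_class_eq[of x y A] by blast
  have fin: "finite (components A)" by (rule finite_components[OF assms(1)])
  \<comment> \<open>If the union were a component, it would be the class of its element
    \<open>x\<close>, that is \<open>?X\<close>, which has been removed.\<close>
  have notin: "?X \<union> ?Y \<notin> components A - {?X, ?Y}"
    using component_eq_class[of "?X \<union> ?Y" A x] conn_refl[OF assms(2)] by auto
  have pos: "card (components A) \<ge> card {?X, ?Y}"
    using in_comps by (intro card_mono fin) auto
  \<comment> \<open>\<open>card {?X, ?Y}\<close> is 1 or 2 according to whether \<open>x\<close> and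
    \<open>y\<close> were already connected, which treats both cases at once.\<close>
  have "card (components (insert {x, y} A)) = Suc (card (components A) - card {?X, ?Y})"
    unfolding components_insert_edge[OF assms(2,3)]
    using notin fin in_comps by (simp add: card_Diff_subset del: card_Diff_insert Un_iff)
  then show ?thesis
    using eq pos by (auto simp: card_insert_if)
qed

text \<open>An edge that merges two components of the larger family also merges two components of the
  smaller one.\<close>

lemma card_components_submodular:
  assumes "finite F" "finite (\<Union>B)" "A \<subseteq> B"
    and "\<And>e. e \<in> F \<Longrightarrow> \<exists>x\<in>\<Union>A. \<exists>y\<in>\<Union>A. e = {x, y}"
  shows "card (components B) + card (components (A \<union> F)) \<le>
    card (components A) + card (components (B \<union> F))"
  using assms(1,4)
proof (induction F rule: finite_induct)
  case (insert e F)
  from insert.prems obtain x y where xy: "x \<in> \<Union>A" "y \<in> \<Union>A" "e = {x, y}" by blast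
  have U: "\<Union>F \<subseteq> \<Union>A" using insert.prems by blast
  have "\<Union>(A \<union> F) = \<Union>A" "\<Union>(B \<union> F) = \<Union>B" "\<Union>A \<subseteq> \<Union>B"
    using U assms(3) by auto
  then have fin: "finite (\<Union>(A \<union> F))" "finite (\<Union>(B \<union> F))"
    using assms(2) finite_subset[of "\<Union>A" "\<Union>B"] by simp_all
  have "conn (A \<union> F) \<subseteq> conn (B \<union> F)" using assms(3) by (intro conn_mono) blast
  moreover have "x \<in> \<Union>(A \<union> F)" "y \<in> \<Union>(A \<union> F)" "x \<in> \<Union>(B \<union> F)" "y \<in> \<Union>(B \<union> F)"
    using xy assms(3) by blast+
  moreover have "A \<union> insert e F = insert {x, y} (A \<union> F)" "B \<union> insert e F = insert {x, y} (B \<union> F)"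
    using xy by auto
  ultimately show ?case
    using insert.IH insert.prems card_components_insert_edge[of "A \<union> F" x y]
      card_components_insert_edge[of "B \<union> F" x y] fin by (auto split: if_splits)
qed simp

text \<open>Sending each class of \<open>A\<close> to the class of \<open>B\<close> that contains it
  is a surjection, because by \<open>meets\<close> every class of \<open>B\<close> contains a vertex
  of \<open>A\<close>. If the two finite numbers agree, the surjection is injective, so
  \<open>B\<close> connects no two vertices of \<open>A\<close> that \<open>A\<close> did not
  connect.\<close>

lemma card_components_coarser:
  assumes "finite (\<Union>A)" "conn A \<subseteq> conn B"
    and meets: "\<And>x. x \<in> \<Union>B \<Longrightarrow> \<exists>y\<in>\<Union>A. (x, y) \<in> conn B"
  shows "card (components B) \<le> card (components A)"
    and "card (components B) = card (components A) \<Longrightarrow> (x, y) \<in> conn B \<Longrightarrow>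
      x \<in> \<Union>A \<Longrightarrow> y \<in> \<Union>A \<Longrightarrow> (x, y) \<in> conn A"
proof -
  define g where "g C = conn B `` C" for C
  have fin: "finite (components A)" by (rule finite_components[OF assms(1)])
  have g: "g (conn A `` {x}) = conn B `` {x}" if "x \<in> \<Union>A" for x
  proof
    show "g (conn A `` {x}) \<subseteq> conn B `` {x}"
      unfolding g_def using assms(2) conn_trans[of x _ B] by blast
    show "conn B `` {x} \<subseteq> g (conn A `` {x})"
      unfolding g_def using conn_refl[OF that] by blast
  qed
  have img: "g ` components A = components B"
  proof (rule set_eqI; rule iffI)
    fix C assume "C \<in> g ` components A"
    then obtain D where "D \<in> components A" "C = g D" by blast
    then obtain x where x: "x \<in> \<Union>A" "C = g (conn A `` {x})"
      unfolding in_components_iff by blast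
    have C: "C = conn B `` {x}" unfolding x(2) by (rule g[OF x(1)])
    have "x \<in> \<Union>B" using x conn_refl[OF x(1)] assms(2) conn_subset[of B] by blast
    then show "C \<in> components B" unfolding C by (rule class_in_components)
  next
    fix C assume "C \<in> components B"
    then obtain x where x: "x \<in> \<Union>B" "C = conn B `` {x}" by (auto simp: in_components_iff)
    obtain y where y: "y \<in> \<Union>A" "(x, y) \<in> conn B" using meets[OF x(1)] by blast
    have "C = conn B `` {y}" using x conn_class_eq[OF y(2)] by simp
    then show "C \<in> g ` components A"
      using g[OF y(1)] class_in_components[OF y(1)] by (metis imageI)
  qed
  then show "card (components B) \<le> card (components A)"
    using card_image_le[OF fin, of g] by simp
  assume "card (components B) = card (components A)" and xy: "(x, y) \<in> conn B" "x \<in> \<Union>A" "y \<in> \<Union>A"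
  then have "inj_on g (components A)"
    using img fin by (intro eq_card_imp_inj_on) simp_all
  moreover have "g (conn A `` {x}) = g (conn A `` {y})"
    unfolding g[OF xy(2)] g[OF xy(3)] using xy(1) by (rule conn_class_eq)
  ultimately have "conn A `` {x} = conn A `` {y}"
    using class_in_components[OF xy(2)] class_in_components[OF xy(3)] by (rule inj_onD)
  then show "(x, y) \<in> conn A"
    using conn_refl[OF xy(3)] by blast
qed

subsection \<open>Eliminating vertices\<close>

text \<open>This forgets the vertices in \<open>M\<close> but keeps the connections made through
  them. Components lying entirely in \<open>M\<close> leave an empty trace and are dropped; when
  \<open>M\<close> is the middle row of a stack, these are the components counted by
  \<open>kappa\<close>.\<close>

definition eliminate :: "'a set \<Rightarrow> 'a set set \<Rightarrow> 'a set set" where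
  "eliminate M A = (\<lambda>C. C - M) ` components A - {{}}"

lemma eliminate_iff:
  "(\<exists>C\<in>eliminate M A. x \<in> C \<and> y \<in> C) \<longleftrightarrow> (x, y) \<in> conn A \<and> x \<notin> M \<and> y \<notin> M"
  unfolding conn_iff_components eliminate_def by auto

lemma partition_on_eliminate: "partition_on (\<Union>A - M) (eliminate M A)"
proof (rule partition_onI)
  show "\<Union>(eliminate M A) = \<Union>A - M"
    unfolding eliminate_def Union_components[symmetric, of A] by blast
  fix C D assume "C \<in> eliminate M A" "D \<in> eliminate M A" "C \<noteq> D"
  then obtain C' D' where "C' \<in> components A" "D' \<in> components A" "C = C' - M" "D = D' - M" "C' \<noteq> D'"
    unfolding eliminate_def by blast
  then show "disjnt C D"
    using disjointD[OF partition_onD2[OF partition_on_components[of A]], of C' D']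
    by (auto simp: disjnt_def)
qed (simp add: eliminate_def)

lemma Union_eliminate [simp]: "\<Union>(eliminate M A) = \<Union>A - M"
  using partition_onD1[OF partition_on_eliminate] by (rule sym)

text \<open>Edges of \<open>X\<close> avoid \<open>M\<close>, so a path in
  \<open>A \<union> X\<close> runs through \<open>M\<close> only along edges of \<open>A\<close>.
  Each such excursion starts and ends outside \<open>M\<close> and can be replaced by a single step
  inside a block of \<open>eliminate M A\<close>.\<close>

lemma conn_eliminate_Un:
  assumes "\<Union>X \<inter> M = {}"
  shows "(x, y) \<in> conn (eliminate M A \<union> X) \<longleftrightarrow> (x, y) \<in> conn (A \<union> X) \<and> x \<notin> M \<and> y \<notin> M"
proof
  let ?E = "eliminate M A \<union> X"
  assume xy: "(x, y) \<in> conn ?E"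
  have "conn ?E \<subseteq> conn (A \<union> X)"
  proof (rule conn_minimal)
    fix B x y assume "B \<in> ?E" "x \<in> B" "y \<in> B"
    then have "(x, y) \<in> conn A \<or> (x, y) \<in> conn X"
      using eliminate_iff[of M A x y] by (blast intro: conn_edge)
    then show "(x, y) \<in> conn (A \<union> X)"
      using conn_mono[of A "A \<union> X"] conn_mono[of X "A \<union> X"] by blast
  qed
  moreover have "x \<in> \<Union>?E" "y \<in> \<Union>?E"
    using xy conn_subset[of ?E] by auto
  then have "x \<notin> M" "y \<notin> M"
    using assms by auto
  ultimately show "(x, y) \<in> conn (A \<union> X) \<and> x \<notin> M \<and> y \<notin> M"
    using xy by blast
next
  let ?E = "eliminate M A \<union> X"
  assume asm: "(x, y) \<in> conn (A \<union> X) \<and> x \<notin> M \<and> y \<notin> M"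
  have el: "(u, v) \<in> conn ?E" if "(u, v) \<in> conn A" "u \<notin> M" "v \<notin> M" for u v
    using that eliminate_iff[of M A u v] by (blast intro: conn_edge)
  have "x \<in> \<Union>(A \<union> X)" using asm conn_subset[of "A \<union> X"] by blast
  then have "x \<in> \<Union>?E" using asm by auto
  then have xx: "(x, x) \<in> conn ?E" by (rule conn_refl)
  \<comment> \<open>Invariant along the path: \<open>z\<close> is a vertex outside \<open>M\<close>
    that the reduced graph already reaches, and the current vertex is \<open>z\<close> itself or is
    connected to \<open>z\<close> within \<open>A\<close>.\<close>
  have extend: "\<exists>z. z \<notin> M \<and> (x, z) \<in> conn ?E \<and> (z = w \<or> (z, w) \<in> conn A)"
    if "z \<notin> M" "(x, z) \<in> conn ?E" "z = u \<or> (z, u) \<in> conn A" "B \<in> A \<union> X" "u \<in> B" "w \<in> B"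
    for z u w B
  proof (cases "B \<in> A")
    case True
    then have "(u, w) \<in> conn A" using that by (blast intro: conn_edge)
    then show ?thesis using that conn_trans[of z u A w] by blast
  next
    case False
    then have B: "B \<in> X" using that by blast
    then have "u \<notin> M" "w \<notin> M" "(u, w) \<in> conn ?E"
      using that assms by (blast intro: conn_edge)+
    moreover have "(x, u) \<in> conn ?E" using that el[of z u] \<open>u \<notin> M\<close> conn_trans[of x z ?E u] by blast
    ultimately show ?thesis using conn_trans[of x u ?E w] by blast
  qed
  have "(x, y) \<in> conn (A \<union> X)" using asm by blast
  then have "\<exists>z. z \<notin> M \<and> (x, z) \<in> conn ?E \<and> (z = y \<or> (z, y) \<in> conn A)"
    unfolding conn_def[of "A \<union> X"]
  proof induction
    case (base y)
    then obtain B where "B \<in> A \<union> X" "x \<in> B" "y \<in> B" by blast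
    then show ?case using extend[of x x] xx asm by blast
  next
    case (step u w)
    then obtain B z where "B \<in> A \<union> X" "u \<in> B" "w \<in> B"
      "z \<notin> M" "(x, z) \<in> conn ?E" "z = u \<or> (z, u) \<in> conn A" by blast
    then show ?case using extend[of z u B w] by blast
  qed
  then show "(x, y) \<in> conn ?E" using el asm conn_trans[of x _ ?E y] by blast
qed

lemma components_eliminate_Un:
  assumes "\<Union>X \<inter> M = {}"
  shows "components (eliminate M A \<union> X) = eliminate M (A \<union> X)"
  by (rule partition_on_eqI[OF partition_on_components partition_on_eliminate])
    (simp add: eliminate_iff conn_eliminate_Un[OF assms] flip: conn_iff_components)

text \<open>Vertices may be eliminated in stages, provided that the edges glued on in between avoid
  the vertices already eliminated. This is what makes composition associative.\<close>

lemma eliminate_eliminate_Un: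
  assumes "\<Union>X \<inter> M = {}"
  shows "eliminate N (eliminate M A \<union> X) = eliminate (M \<union> N) (A \<union> X)"
proof -
  have "eliminate N (eliminate M A \<union> X) = (\<lambda>C. C - N) ` eliminate M (A \<union> X) - {{}}"
    unfolding eliminate_def[of N] components_eliminate_Un[OF assms] ..
  also have "\<dots> = (\<lambda>C. C - N) ` (\<lambda>C. C - M) ` components (A \<union> X) - {{}}"
    unfolding eliminate_def by blast
  also have "\<dots> = eliminate (M \<union> N) (A \<union> X)"
    unfolding eliminate_def image_image by (simp add: Diff_Un Diff_eq Int_assoc)
  finally show ?thesis .
qed

text \<open>Components not contained in \<open>M\<close> keep a nonempty trace outside
  \<open>M\<close>, and distinct components have disjoint traces, so only the components inside
  \<open>M\<close> are lost.\<close>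

lemma card_components_eliminate:
  assumes "finite (\<Union>A)"
  shows "card (components A) = card (eliminate M A) + card {C \<in> components A. C \<subseteq> M}"
proof -
  let ?in = "{C \<in> components A. C \<subseteq> M}" and ?out = "{C \<in> components A. \<not> C \<subseteq> M}"
  have fin: "finite (components A)" by (rule finite_components[OF assms])
  have "eliminate M A = (\<lambda>C. C - M) ` ?out"
    unfolding eliminate_def by blast
  moreover have "inj_on (\<lambda>C. C - M) ?out"
  proof (rule inj_onI)
    fix C D assume *: "C \<in> ?out" "D \<in> ?out" "C - M = D - M"
    then obtain x where "x \<in> C" "x \<in> D" by blast
    then show "C = D"
      using * component_eq_class[of C A x] component_eq_class[of D A x] by simp
  qed
  ultimately have "card (eliminate M A) = card ?out"
    by (simp add: card_image)
  moreover have "card (components A) = card ?out + card ?in"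
    using fin by (subst card_Un_disjoint[symmetric]) (auto intro: arg_cong[where f = card])
  ultimately show ?thesis by simp
qed

text \<open>No edge of \<open>X\<close> touches \<open>M\<close>, so gluing on \<open>X\<close> can
  neither enlarge nor create a component that stays inside \<open>M\<close>. The number of
  components lost by elimination is therefore independent of \<open>X\<close>.\<close>

lemma components_inside_Un:
  assumes "\<Union>X \<inter> M = {}"
  shows "{C \<in> components (A \<union> X). C \<subseteq> M} = {C \<in> components A. C \<subseteq> M}"
proof -
  have cls: "conn (A \<union> X) `` {x} = conn A `` {x}" if "conn A `` {x} \<subseteq> M" "x \<in> M" for x
  proof
    have "(x, y) \<in> conn A" if "(x, y) \<in> conn (A \<union> X)" for y
      using that unfolding conn_def[of "A \<union> X"]
    proof induction
      case (base y)
      then show ?case using \<open>x \<in> M\<close> assms by (blast intro: conn_edge)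
    next
      case (step y z)
      then have "y \<in> M" using \<open>conn A `` {x} \<subseteq> M\<close> by blast
      then have "(y, z) \<in> conn A" using step assms by (blast intro: conn_edge)
      with step show ?case using conn_trans by fast
    qed
    then show "conn (A \<union> X) `` {x} \<subseteq> conn A `` {x}" by blast
    show "conn A `` {x} \<subseteq> conn (A \<union> X) `` {x}" using conn_mono[of A "A \<union> X"] by blast
  qed
  have mono: "conn A `` {x} \<subseteq> conn (A \<union> X) `` {x}" for x
    using conn_mono[of A "A \<union> X"] by blast
  show ?thesis
  proof (rule set_eqI; rule iffI)
    fix C assume "C \<in> {C \<in> components (A \<union> X). C \<subseteq> M}"
    then obtain x where x: "x \<in> \<Union>(A \<union> X)" "C = conn (A \<union> X) `` {x}" "C \<subseteq> M"
      by (auto simp: in_components_iff)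
    then have "x \<in> M" using conn_refl[OF x(1)] by blast
    moreover have "x \<in> \<Union>A" using x \<open>x \<in> M\<close> assms by blast
    ultimately show "C \<in> {C \<in> components A. C \<subseteq> M}"
      using x mono[of x] cls[of x] by (auto simp: in_components_iff)
  next
    fix C assume "C \<in> {C \<in> components A. C \<subseteq> M}"
    then obtain x where x: "x \<in> \<Union>A" "C = conn A `` {x}" "C \<subseteq> M"
      by (auto simp: in_components_iff)
    then have "x \<in> M" using conn_refl[OF x(1)] by blast
    then show "C \<in> {C \<in> components (A \<union> X). C \<subseteq> M}"
      using x cls[of x] by (auto simp: in_components_iff)
  qed
qed

lemma card_components_eliminate_Un:
  assumes "finite (\<Union>(A \<union> X))" "\<Union>X \<inter> M = {}"
  shows "card (components (A \<union> X)) =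
    card (components (eliminate M A \<union> X)) + card {C \<in> components A. C \<subseteq> M}"
  unfolding components_eliminate_Un[OF assms(2)]
  by (simp add: card_components_eliminate[OF assms(1), of M] components_inside_Un[OF assms(2)])

lemma eliminate_image:
  assumes "inj f" "\<And>x. f x \<in> M \<longleftrightarrow> x \<in> N"
  shows "eliminate M ((`) f ` A) = (`) f ` eliminate N A"
proof -
  have "f ` C - M = f ` (C - N)" for C
    using assms(2) by blast
  then have "(\<lambda>C. C - M) ` (`) f ` components A = (`) f ` (\<lambda>C. C - N) ` components A"
    unfolding image_image by simp
  moreover have "(`) f ` X - {{}} = (`) f ` (X - {{}})" for X
    by auto
  ultimately show ?thesis
    unfolding eliminate_def components_image[OF assms(1)] by simp
qed

lemma eliminate_disjoint_Un:
  assumes "\<Union>A \<inter> \<Union>B = {}"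
  shows "eliminate M (A \<union> B) = eliminate M A \<union> eliminate M B"
  unfolding eliminate_def components_disjoint_Un[OF assms] by blast

subsection \<open>Diagrams on rows of vertices\<close>

text \<open>The vertex \<open>i\<close> of row \<open>r\<close> is encoded as the pair \<open>(r, i)\<close>.\<close>

fun place :: "nat \<Rightarrow> nat \<Rightarrow> nat vertex \<Rightarrow> nat \<times> nat" where
  "place a b (Top i) = (a, i)"
| "place a b (Bottom i) = (b, i)"

text \<open>Numbered rows allow a diagram to be placed between any two rows, and hence three
  diagrams to be stacked in one graph, whereas \<open>node\<close> provides exactly three
  rows.\<close>

definition strand :: "nat \<Rightarrow> nat \<Rightarrow> diagram \<Rightarrow> (nat \<times> nat) set set" where
  "strand a b p = (`) (place a b) ` p"

abbreviation row :: "nat \<Rightarrow> (nat \<times> nat) set" where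
  "row b \<equiv> {b} \<times> UNIV"

lemma inj_place: "a \<noteq> b \<Longrightarrow> inj (place a b)"
proof (rule injI)
  fix x y assume "a \<noteq> b" "place a b x = place a b y"
  then show "x = y" by (cases x; cases y) auto
qed

lemma strand_Un: "strand a b (p \<union> q) = strand a b p \<union> strand a b q"
  by (simp add: strand_def image_Un)

lemma strand_eq_iff: "a \<noteq> b \<Longrightarrow> strand a b p = strand a b q \<longleftrightarrow> p = q"
  unfolding strand_def by (intro inj_image_eq_iff inj_image_set inj_place)

lemma card_strand: "a \<noteq> b \<Longrightarrow> card (strand a b p) = card p"
  unfolding strand_def
  by (rule card_image) (rule inj_on_subset[OF inj_image_set[OF inj_place] subset_UNIV])

lemma Union_strand_row:
  assumes "a \<noteq> r" "b \<noteq> r"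
  shows "\<Union>(strand a b p) \<inter> row r = {}"
proof (rule equals0I)
  fix z assume "z \<in> \<Union>(strand a b p) \<inter> row r"
  then obtain x where "z = place a b x" "fst z = r"
    by (auto simp: strand_def) (metis fst_conv)
  then show False using assms by (cases x) simp_all
qed

lemma components_strand: "a \<noteq> b \<Longrightarrow> components (strand a b p) = strand a b (components p)"
  unfolding strand_def by (rule components_image[OF inj_place])

text \<open>The equivalence also allows reading back: a family known only through its injective
  image is recognised as a partition, as in \<open>compose_diagrams\<close> and
  \<open>juxtapose_split\<close>.\<close>

lemma partition_on_image_iff:
  assumes "inj f"
  shows "partition_on (f ` A) ((`) f ` P) \<longleftrightarrow> partition_on A P"
proof -
  have "\<Union>((`) f ` P) = f ` A \<longleftrightarrow> \<Union>P = A"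
    unfolding image_Union[symmetric] by (rule inj_image_eq_iff[OF assms])
  moreover have "{} \<in> (`) f ` P \<longleftrightarrow> {} \<in> P" by auto
  moreover have "disjoint ((`) f ` P) \<longleftrightarrow> disjoint P"
    unfolding disjoint_def by (simp add: inj_image_eq_iff[OF assms] image_Int[OF assms, symmetric])
  ultimately show ?thesis unfolding partition_on_def by (simp only:)
qed

lemma place_vertices: "place a b ` vertices k = {a, b} \<times> {1..k}"
  unfolding vertices_def image_Un image_image by auto

lemma partition_on_strand:
  "a \<noteq> b \<Longrightarrow> partition_on ({a, b} \<times> {1..k}) (strand a b p) \<longleftrightarrow> p \<in> diagrams k"
  unfolding strand_def place_vertices[symmetric]
  by (simp add: partition_on_image_iff[OF inj_place] diagrams_def)

lemma diagrams_partition: "p \<in> diagrams k \<Longrightarrow> partition_on (vertices k) p"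
  by (simp add: diagrams_def)

lemma Union_strand: "p \<in> diagrams k \<Longrightarrow> \<Union>(strand a b p) = {a, b} \<times> {1..k}"
  unfolding strand_def image_Union[symmetric]
  using partition_onD1[OF diagrams_partition] place_vertices[of a b k] by simp

lemma components_diagram: "p \<in> diagrams k \<Longrightarrow> components p = p"
  by (rule components_partition[OF diagrams_partition])

text \<open>A dictionary between the graph in the definition of \<open>compose\<close> and numbered
  rows: \<open>h\<close> sends upper, middle and lower nodes to rows \<open>a\<close>,
  \<open>b\<close> and \<open>c\<close>. The right factor \<open>p'\<close> lies on top, hence
  between \<open>a\<close> and \<open>b\<close>.\<close>

lemma stack_strand:
  assumes "a \<noteq> b" "b \<noteq> c" "a \<noteq> c"
  obtains h where "inj h" "components (strand a b p' \<union> strand b c p) = (`) h ` stack_components p p'"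
    "\<And>C. h ` C - row b = place a c ` (outer_node -` C)"
    "\<And>C. h ` C \<subseteq> row b \<longleftrightarrow> C \<subseteq> range Middle"
proof -
  define h where "h n = (case n of Upper i \<Rightarrow> (a, i) | Middle i \<Rightarrow> (b, i) | Lower i \<Rightarrow> (c, i))"
    for n :: "nat node"
  have inj: "inj h"
  proof (rule injI)
    fix x y assume "h x = h y"
    then show "x = y" using assms by (cases x; cases y) (auto simp: h_def)
  qed
  have pl: "place a b = (\<lambda>x. h (upper_node x))" "place b c = (\<lambda>x. h (lower_node x))"
    "place a c = (\<lambda>x. h (outer_node x))"
    by (rule ext, case_tac x; simp add: h_def)+
  have row: "h n \<in> row b \<longleftrightarrow> n \<in> range Middle" for n
    using assms by (cases n) (auto simp: h_def)
  \<comment> \<open>The nodes outside the middle row are exactly the values of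
    \<open>outer_node\<close>, so taking the preimage under \<open>outer_node\<close> amounts to
    deleting the middle row.\<close>
  have outer: "n \<notin> range Middle \<longleftrightarrow> n \<in> range outer_node" for n :: "nat node"
  proof (cases n)
    case (Upper i) then show ?thesis using rangeI[of outer_node "Top i"] by auto
  next
    case (Middle i)
    have "Middle i \<noteq> outer_node x" for x by (cases x) auto
    with Middle show ?thesis by auto
  next
    case (Lower i) then show ?thesis using rangeI[of outer_node "Bottom i"] by auto
  qed
  show thesis
  proof (rule that[OF inj])
    have "strand a b p' \<union> strand b c p = (`) h ` ((`) upper_node ` p' \<union> (`) lower_node ` p)"
      unfolding strand_def image_Un image_image pl ..
    then show "components (strand a b p' \<union> strand b c p) = (`) h ` stack_components p p'"
      unfolding stack_components_def by (simp only: components_image[OF inj])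
    show "h ` C - row b = place a c ` (outer_node -` C)" for C
    proof -
      have "h ` C - M = {h n |n. n \<in> C \<and> h n \<notin> M}" for M
        by blast
      from this[of "row b"] have "h ` C - row b = {h n |n. n \<in> C \<and> h n \<notin> row b}" .
      also have "\<dots> = {h n |n. n \<in> C \<and> n \<in> range outer_node}"
        by (simp only: row outer)
      also have "\<dots> = place a c ` (outer_node -` C)"
        unfolding pl by blast
      finally show ?thesis .
    qed
    show "h ` C \<subseteq> row b \<longleftrightarrow> C \<subseteq> range Middle" for C
      unfolding image_subset_iff row subset_eq[of C] ..
  qed
qed

text \<open>Composition is elimination of the middle row: on both sides the middle vertices are
  removed and the components left empty are discarded.\<close>

lemma strand_compose:
  assumes "a \<noteq> b" "b \<noteq> c" "a \<noteq> c"
  shows "strand a c (compose p p') = eliminate (row b) (strand a b p' \<union> strand b c p)"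
proof -
  obtain h where h: "components (strand a b p' \<union> strand b c p) = (`) h ` stack_components p p'"
    "\<And>C. h ` C - row b = place a c ` (outer_node -` C)"
    using stack_strand[OF assms] by metis
  have "strand a c (compose p p') = (`) (place a c) ` (\<lambda>C. outer_node -` C) ` stack_components p p' - {{}}"
    unfolding strand_def compose_def by auto
  also have "(`) (place a c) ` (\<lambda>C. outer_node -` C) ` stack_components p p' =
      (\<lambda>C. C - row b) ` (`) h ` stack_components p p'"
    unfolding image_image h(2) ..
  finally show ?thesis
    unfolding eliminate_def h(1) .
qed

lemma kappa_strand:
  assumes "a \<noteq> b" "b \<noteq> c" "a \<noteq> c"
  shows "kappa p p' = card {C \<in> components (strand a b p' \<union> strand b c p). C \<subseteq> row b}"
proof -
  obtain h where h: "inj h" "components (strand a b p' \<union> strand b c p) = (`) h ` stack_components p p'"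
    "\<And>C. h ` C \<subseteq> row b \<longleftrightarrow> C \<subseteq> range Middle"
    using stack_strand[OF assms] by metis
  have "{C \<in> components (strand a b p' \<union> strand b c p). C \<subseteq> row b} =
      (`) h ` {C \<in> stack_components p p'. C \<subseteq> range Middle}"
    unfolding h(2) using h(3) by blast
  then show ?thesis
    unfolding kappa_def by (simp add: card_image inj_on_subset[OF inj_image_set[OF h(1)]])
qed

lemma compose_diagrams:
  assumes "p \<in> diagrams k" "p' \<in> diagrams k"
  shows "compose p p' \<in> diagrams k"
proof -
  have "\<Union>(strand 0 1 p' \<union> strand 1 2 p) - row 1 = {0, 2} \<times> {1..k}"
    unfolding Union_Un_distrib Union_strand[OF assms(1)] Union_strand[OF assms(2)] by auto
  then have "partition_on ({0, 2} \<times> {1..k}) (strand 0 2 (compose p p'))"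
    using partition_on_eliminate[of "strand 0 1 p' \<union> strand 1 2 p" "row 1"]
    by (simp add: strand_compose[of 0 1 2])
  then show ?thesis using partition_on_strand[of 0 2 k "compose p p'"] by simp
qed

text \<open>Both bracketings eliminate rows 1 and 2 from the same four-row graph, with
  \<open>p3\<close> on top and \<open>p1\<close> at the bottom; they differ only in which row goes
  first.\<close>

lemma compose_assoc: "compose (compose p1 p2) p3 = compose p1 (compose p2 p3)"
proof -
  have compose: "strand 1 3 (compose p1 p2) = eliminate (row 2) (strand 1 2 p2 \<union> strand 2 3 p1)"
    "strand 0 2 (compose p2 p3) = eliminate (row 1) (strand 0 1 p3 \<union> strand 1 2 p2)"
    by (rule strand_compose; simp)+
  have "strand 0 3 (compose (compose p1 p2) p3) =
      eliminate (row 1) (strand 0 1 p3 \<union> strand 1 3 (compose p1 p2))"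
    by (rule strand_compose) auto
  also have "\<dots> = eliminate (row 1) (eliminate (row 2) (strand 1 2 p2 \<union> strand 2 3 p1) \<union> strand 0 1 p3)"
    unfolding compose by (simp only: Un_commute)
  also have "\<dots> = eliminate (row 2 \<union> row 1) (strand 1 2 p2 \<union> strand 2 3 p1 \<union> strand 0 1 p3)"
    by (rule eliminate_eliminate_Un[OF Union_strand_row]) auto
  also have "\<dots> = eliminate (row 1 \<union> row 2) (strand 0 1 p3 \<union> strand 1 2 p2 \<union> strand 2 3 p1)"
    by (simp only: Un_ac)
  also have "\<dots> = eliminate (row 2) (eliminate (row 1) (strand 0 1 p3 \<union> strand 1 2 p2) \<union> strand 2 3 p1)"
    by (rule eliminate_eliminate_Un[OF Union_strand_row, symmetric]) auto
  also have "\<dots> = strand 0 3 (compose p1 (compose p2 p3))"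
    unfolding compose[symmetric] by (rule strand_compose[symmetric]) auto
  finally show ?thesis by (simp add: strand_eq_iff)
qed

text \<open>Replacing two stacked diagrams by their composite loses exactly
  \<open>kappa p p'\<close> components, even with a further graph \<open>X\<close> attached, as long
  as \<open>X\<close> stays away from the glued row.\<close>

lemma card_components_stack_Un:
  assumes "a \<noteq> b" "b \<noteq> c" "a \<noteq> c" "p \<in> diagrams k" "p' \<in> diagrams k"
    and "finite (\<Union>X)" "\<Union>X \<inter> row b = {}"
  shows "card (components (strand a b p' \<union> strand b c p \<union> X)) =
    card (components (strand a c (compose p p') \<union> X)) + kappa p p'"
proof -
  have "finite (\<Union>(strand a b p' \<union> strand b c p \<union> X))"
    unfolding Union_Un_distrib using assms by (simp add: Union_strand)
  from card_components_eliminate_Un[OF this assms(7)] show ?thesis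
    by (simp add: strand_compose[OF assms(1-3)] kappa_strand[OF assms(1-3)])
qed

lemma card_components_stack:
  assumes "a \<noteq> b" "b \<noteq> c" "a \<noteq> c" "p \<in> diagrams k" "p' \<in> diagrams k"
  shows "card (components (strand a b p' \<union> strand b c p)) = nc (compose p p') + kappa p p'"
  using card_components_stack_Un[OF assms, of "{}"] assms
  by (simp add: components_strand components_diagram[OF compose_diagrams[OF assms(4,5)]]
      card_strand nc_def)

text \<open>The components of the four-row graph of \<open>p1\<close>, \<open>p2\<close>,
  \<open>p3\<close> are counted twice, once eliminating row 2 before row 1 and once in the other
  order. Both counts contain the number of blocks of the triple composite, which cancels.\<close>

lemma kappa_cocycle:
  assumes "p1 \<in> diagrams k" "p2 \<in> diagrams k" "p3 \<in> diagrams k"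
  shows "kappa p1 p2 + kappa (compose p1 p2) p3 = kappa p2 p3 + kappa p1 (compose p2 p3)"
proof -
  have fin: "finite (\<Union>(strand a b p))" if "p \<in> diagrams k" for a b p
    by (simp add: Union_strand[OF that])
  have "card (components (strand 1 2 p2 \<union> strand 2 3 p1 \<union> strand 0 1 p3)) =
      card (components (strand 1 3 (compose p1 p2) \<union> strand 0 1 p3)) + kappa p1 p2"
    by (rule card_components_stack_Un[OF _ _ _ assms(1,2) fin[OF assms(3)] Union_strand_row]) auto
  moreover have "card (components (strand 0 1 p3 \<union> strand 1 3 (compose p1 p2))) =
      nc (compose (compose p1 p2) p3) + kappa (compose p1 p2) p3"
    by (rule card_components_stack[OF _ _ _ compose_diagrams[OF assms(1,2)] assms(3)]) auto
  moreover have "card (components (strand 0 1 p3 \<union> strand 1 2 p2 \<union> strand 2 3 p1)) =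
      card (components (strand 0 2 (compose p2 p3) \<union> strand 2 3 p1)) + kappa p2 p3"
    by (rule card_components_stack_Un[OF _ _ _ assms(2,3) fin[OF assms(1)] Union_strand_row]) auto
  moreover have "card (components (strand 0 2 (compose p2 p3) \<union> strand 2 3 p1)) =
      nc (compose p1 (compose p2 p3)) + kappa p1 (compose p2 p3)"
    by (rule card_components_stack[OF _ _ _ assms(1) compose_diagrams[OF assms(2,3)]]) auto
  moreover have "strand 1 2 p2 \<union> strand 2 3 p1 \<union> strand 0 1 p3 = strand 0 1 p3 \<union> strand 1 2 p2 \<union> strand 2 3 p1"
    "strand 1 3 (compose p1 p2) \<union> strand 0 1 p3 = strand 0 1 p3 \<union> strand 1 3 (compose p1 p2)"
    by blast+
  ultimately show ?thesis by (simp add: compose_assoc)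
qed

subsection \<open>The defect of a composition\<close>

definition nc_join_id :: "nat \<Rightarrow> diagram \<Rightarrow> nat" where
  "nc_join_id k p = card (components (p \<union> id_diagram k))"

text \<open>This is the right-hand side minus the left-hand side of the equation defining
  \<open>kreweras\<close>. Integer values keep the differences of block numbers free of truncation
  and of halves.\<close>

definition defect :: "nat \<Rightarrow> diagram \<Rightarrow> diagram \<Rightarrow> int" where
  "defect k p1 p2 = (int (nc p1) - int (nc_join_id k p1)) + (int (nc p2) - int (nc_join_id k p2))
    - (int (nc (compose p1 p2)) - int (nc_join_id k (compose p1 p2))) - int (kappa p1 p2)"

lemma id_diagram_image: "id_diagram k = (\<lambda>i. {Top i, Bottom i}) ` {1..k}"
  unfolding id_diagram_def by blast

lemma nc_id_diagram: "nc (id_diagram k) = k"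
  unfolding nc_def id_diagram_image by (subst card_image) (auto simp: inj_on_def doubleton_eq_iff)

text \<open>In the Kreweras equation all terms in \<open>k\<close> cancel and the halves of the
  block numbers combine to whole ones, leaving the vanishing of the defect.\<close>

lemma factorizations_iff:
  "(p1, p2) \<in> factorizations k p \<longleftrightarrow>
    p1 \<in> diagrams k \<and> p2 \<in> diagrams k \<and> compose p1 p2 = p \<and> defect k p1 p2 = 0"
proof (cases "p1 \<in> diagrams k \<and> p2 \<in> diagrams k")
  case True
  have d: "dist_diagram k (id_diagram k) p = (real k + real (nc p)) / 2 - real (nc_join_id k p)"
    if "p \<in> diagrams k" for p
    using join_eq_components[OF id_diagram_diagrams that]
    using nc_id_diagram[of k] by (simp add: dist_diagram_def nc_join_id_def nc_def Un_commute)
  have "defect k p1 p2 = 0 \<longleftrightarrow> real_of_int (defect k p1 p2) = 0" by simp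
  also have "\<dots> \<longleftrightarrow> dist_diagram k (id_diagram k) (compose p1 p2) =
       dist_diagram k (id_diagram k) p1 + dist_diagram k (id_diagram k) p2
       - (real k + real (nc (compose p1 p2)) - real (nc p1) - real (nc p2)) / 2 - real (kappa p1 p2)"
    using True compose_diagrams[of p1 k p2] by (simp add: d defect_def field_simps) auto
  finally show ?thesis
    using True by (auto simp: factorizations_def kreweras_def)
qed (auto simp: factorizations_def)

lemma strand_id_diagram: "strand a b (id_diagram k) = (\<lambda>i. {(a, i), (b, i)}) ` {1..k}"
  unfolding strand_def id_diagram_image image_image by simp

lemma strand_id_doubletons:
  assumes "e \<in> strand a b (id_diagram k)" "a \<in> R" "b \<in> R"
  shows "\<exists>x\<in>R \<times> {1..k}. \<exists>y\<in>R \<times> {1..k}. e = {x, y}"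
proof -
  obtain i where "i \<in> {1..k}" "e = {(a, i), (b, i)}"
    using assms(1) unfolding strand_id_diagram by blast
  then show ?thesis using assms(2,3) by (intro bexI[of _ "(a, i)"] bexI[of _ "(b, i)"]) simp_all
qed

lemma conn_strand_id:
  assumes "strand a b (id_diagram k) \<subseteq> A" "i \<in> {1..k}"
  shows "((a, i), (b, i)) \<in> conn A"
proof (rule conn_edge)
  show "{(a, i), (b, i)} \<in> A"
    using assms unfolding strand_id_diagram by (auto dest: subsetD)
qed simp_all

lemma nc_join_id_strand:
  assumes "a \<noteq> b"
  shows "card (components (strand a b p \<union> strand a b (id_diagram k))) = nc_join_id k p"
  using assms by (simp add: components_strand card_strand nc_join_id_def flip: strand_Un)

text \<open>\<open>G\<close> is the three-row stack with vertical edges joining all rows;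
  \<open>H\<close> keeps only the outer rows, with the composite and its own vertical edges. The
  defect is bounded below by the number of components of \<open>H\<close> minus that of
  \<open>G\<close>, and this difference is nonnegative because \<open>H\<close> is the finer
  graph.\<close>

lemma defect_inequality:
  assumes p1: "p1 \<in> diagrams k" and p2: "p2 \<in> diagrams k"
  defines "G \<equiv> strand 0 1 p2 \<union> strand 1 2 p1 \<union> strand 1 2 (id_diagram k) \<union> strand 0 1 (id_diagram k)"
  defines "H \<equiv> strand 0 2 (compose p1 p2) \<union> strand 0 2 (id_diagram k)"
  shows "defect k p1 p2 \<ge> 0"
    and "defect k p1 p2 = 0 \<Longrightarrow> (x, y) \<in> conn G \<Longrightarrow> x \<in> {0, 2} \<times> {1..k} \<Longrightarrow> y \<in> {0, 2} \<times> {1..k} \<Longrightarrow>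
      (x, y) \<in> conn H"
proof -
  let ?A01 = "strand 0 1 p2" and ?A12 = "strand 1 2 p1"
  let ?I12 = "strand 1 2 (id_diagram k)" and ?I01 = "strand 0 1 (id_diagram k)"
  note id = id_diagram_diagrams[of k]
  note U = Union_strand[OF p1] Union_strand[OF p2] Union_strand[OF id]
    Union_strand[OF compose_diagrams[OF p1 p2]]
  have finI: "finite (strand a b (id_diagram k))" for a b
    by (simp add: strand_id_diagram)
  have UG: "\<Union>G = {0, 1, 2} \<times> {1..k}" and UH: "\<Union>H = {0, 2} \<times> {1..k}"
    unfolding G_def H_def Union_Un_distrib U by auto
  have 0: "card (components (?A01 \<union> ?A12)) = nc (compose p1 p2) + kappa p1 p2"
    by (rule card_components_stack[OF _ _ _ p1 p2]) auto
  \<comment> \<open>Submodularity: the vertical edges between rows 1 and 2 remove no more components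
    from the whole stack than from \<open>p1\<close> alone, where they remove
    \<open>nc p1 - nc_join_id k p1\<close>. The next estimate does the same for \<open>p2\<close>
    and rows 0 and 1.\<close>
  have 1: "card (components (?A01 \<union> ?A12)) + card (components (?A12 \<union> ?I12)) \<le>
      card (components ?A12) + card (components (?A01 \<union> ?A12 \<union> ?I12))"
  proof (rule card_components_submodular[OF finI])
    show "finite (\<Union>(?A01 \<union> ?A12))" unfolding Union_Un_distrib U by simp
  qed (use strand_id_doubletons[of _ 1 2 k "{1, 2}"] in \<open>auto simp: U\<close>)
  have 2: "card (components (?A01 \<union> ?A12 \<union> ?I12)) + card (components (?A01 \<union> ?I01)) \<le>
      card (components ?A01) + card (components G)"
    unfolding G_def
  proof (rule card_components_submodular[OF finI])
    show "finite (\<Union>(?A01 \<union> ?A12 \<union> ?I12))" unfolding Union_Un_distrib U by simp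
  qed (use strand_id_doubletons[of _ 0 1 k "{0, 1}"] in \<open>auto simp: U\<close>)
  have sub: "conn H \<subseteq> conn G"
  proof (rule conn_minimal)
    fix B x y assume B: "B \<in> H" "x \<in> B" "y \<in> B"
    show "(x, y) \<in> conn G"
    proof (cases "B \<in> strand 0 2 (compose p1 p2)")
      case True
      then have "(x, y) \<in> conn (?A01 \<union> ?A12)"
        using eliminate_iff[of "row 1" "?A01 \<union> ?A12" x y] B by (auto simp: strand_compose[of 0 1 2])
      then show ?thesis
        using conn_mono[of "?A01 \<union> ?A12" G] by (auto simp: G_def)
    next
      case False
      then have "B \<in> strand 0 2 (id_diagram k)" using B by (auto simp: H_def)
      then obtain i where i: "i \<in> {1..k}" "B = {(0, i), (2, i)}"
        unfolding strand_id_diagram by blast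
      have "((0, i), (1, i)) \<in> conn G" "((1, i), (2, i)) \<in> conn G"
        using i(1) by (auto intro!: conn_strand_id simp: G_def)
      then have "((0, i), (2, i)) \<in> conn G" by (rule conn_trans)
      moreover have "((0, i), (0, i)) \<in> conn G" "((2, i), (2, i)) \<in> conn G"
        using i(1) UG by (auto intro!: conn_refl)
      ultimately show ?thesis
        using B(2,3) conn_sym[of "(0, i)" "(2, i)" G] unfolding i(2) by blast
    qed
  qed
  \<comment> \<open>A vertex of the middle row is tied to row 2 by its vertical edge, so every
    component of \<open>G\<close> reaches an outer row.\<close>
  have meets: "\<exists>y\<in>\<Union>H. (x, y) \<in> conn G" if x: "x \<in> \<Union>G" for x
  proof (cases "x \<in> \<Union>H")
    case True
    then show ?thesis using conn_refl[OF that] by blast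
  next
    case False
    then obtain i where "x = (1, i)" "i \<in> {1..k}"
      using x unfolding UG UH by (cases x) auto
    then show ?thesis
      using conn_strand_id[of 1 2 k G i] unfolding UH G_def by blast
  qed
  have finH: "finite (\<Union>H)" unfolding UH by simp
  note coarser = card_components_coarser[OF finH sub meets]
  have "card (components H) = nc_join_id k (compose p1 p2)"
    unfolding H_def by (rule nc_join_id_strand) simp
  moreover have "card (components (?A12 \<union> ?I12)) = nc_join_id k p1"
    "card (components (?A01 \<union> ?I01)) = nc_join_id k p2"
    by (rule nc_join_id_strand; simp)+
  moreover have "card (components ?A12) = nc p1" "card (components ?A01) = nc p2"
    by (simp_all add: components_strand components_diagram[OF p1] components_diagram[OF p2]
        card_strand nc_def)
  \<comment> \<open>The difference of the component numbers is squeezed between 0 and the defect, so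
    defect zero is the equality case of \<open>card_components_coarser\<close>.\<close>
  ultimately have *: "0 \<le> int (card (components H)) - int (card (components G))"
    "int (card (components H)) - int (card (components G)) \<le> defect k p1 p2"
    using 0 1 2 coarser(1) unfolding defect_def by linarith+
  then show "defect k p1 p2 \<ge> 0" by linarith
  assume "defect k p1 p2 = 0" and xy: "(x, y) \<in> conn G" "x \<in> {0, 2} \<times> {1..k}" "y \<in> {0, 2} \<times> {1..k}"
  then have "card (components G) = card (components H)" using * by linarith
  then show "(x, y) \<in> conn H" using xy coarser(2) unfolding UH by blast
qed

lemmas defect_nonneg = defect_inequality(1)
  and defect_eq_0D = defect_inequality(2)

text \<open>The terms \<open>nc - nc_join_id\<close> of the intermediate composites cancel, and
  those of \<open>p1\<close>, \<open>p2\<close>, \<open>p3\<close> and the triple composite are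
  common to both sides. What remains is \<open>kappa_cocycle\<close>.\<close>

lemma defect_cocycle:
  assumes "p1 \<in> diagrams k" "p2 \<in> diagrams k" "p3 \<in> diagrams k"
  shows "defect k p1 p2 + defect k (compose p1 p2) p3 = defect k p2 p3 + defect k p1 (compose p2 p3)"
  using kappa_cocycle[OF assms] by (simp add: defect_def compose_assoc)

subsection \<open>Composition with the identity\<close>

text \<open>The vertical edges merely carry the bottom of \<open>p\<close> from row \<open>b\<close>
  to row \<open>c\<close>. General row numbers let the same lemma serve both unit laws, the second
  one by reading the stack from bottom to top.\<close>

lemma eliminate_strand_id:
  assumes "a \<noteq> b" "b \<noteq> c" "a \<noteq> c" and p: "p \<in> diagrams k"
  shows "eliminate (row b) (strand a b p \<union> strand b c (id_diagram k)) = strand a c p"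
proof (rule partition_on_eqI[OF partition_on_eliminate])
  let ?A = "strand a b p \<union> strand b c (id_diagram k)"
  show "partition_on ({a, c} \<times> {1..k}) (strand a c p)"
    using partition_on_strand[OF assms(3)] p by blast
  have part: "partition_on ({a, b} \<times> {1..k}) (strand a b p)"
    using partition_on_strand[OF assms(1)] p by blast
  note U = Union_strand[OF p] Union_strand[OF id_diagram_diagrams]
  \<comment> \<open>\<open>\<pi>\<close> contracts row \<open>c\<close> onto row \<open>b\<close>.
    Vertical edges shrink to points, so a path in \<open>?A\<close> projects to a path inside
    \<open>strand a b p\<close>, whose components are its blocks.\<close>
  define \<pi> where "\<pi> z = (if fst z = c then (b, snd z) else z)" for z :: "nat \<times> nat"
  have \<pi>: "\<pi> (place a c u) = place a b u" for u
    using assms(3) by (cases u) (simp_all add: \<pi>_def)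
  have edge: "(\<pi> x, \<pi> y) \<in> conn (strand a b p)" if B: "B \<in> ?A" "x \<in> B" "y \<in> B" for B x y
  proof (cases "B \<in> strand a b p")
    case True
    then have "x \<in> \<Union>(strand a b p)" "y \<in> \<Union>(strand a b p)"
      using B by blast+
    then have "x \<in> {a, b} \<times> {1..k}" "y \<in> {a, b} \<times> {1..k}"
      unfolding U(1) .
    then have "\<pi> x = x" "\<pi> y = y" using assms(2,3) by (auto simp: \<pi>_def)
    then show ?thesis using conn_edge[OF True B(2,3)] by simp
  next
    case False
    then obtain i where i: "i \<in> {1..k}" "B = {(b, i), (c, i)}"
      using B(1) unfolding strand_id_diagram by blast
    then have "\<pi> x = (b, i)" "\<pi> y = (b, i)" using B(2,3) assms(2) by (auto simp: \<pi>_def)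
    moreover have "(b, i) \<in> \<Union>(strand a b p)" unfolding U(1) using i(1) by simp
    ultimately show ?thesis by (simp only: conn_refl)
  qed
  fix x y
  show "(\<exists>B\<in>eliminate (row b) ?A. x \<in> B \<and> y \<in> B) \<longleftrightarrow> (\<exists>B\<in>strand a c p. x \<in> B \<and> y \<in> B)"
    unfolding eliminate_iff
  proof
    assume xy: "(x, y) \<in> conn ?A \<and> x \<notin> row b \<and> y \<notin> row b"
    have "\<Union>?A \<subseteq> {a, b, c} \<times> {1..k}" unfolding Union_Un_distrib U by auto
    moreover have "x \<in> \<Union>?A" "y \<in> \<Union>?A"
      using xy subsetD[OF conn_subset[of ?A]] by blast+
    ultimately have "x \<in> {a, b, c} \<times> {1..k}" "y \<in> {a, b, c} \<times> {1..k}"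
      by (simp_all only: subsetD)
    then have "x \<in> place a c ` vertices k" "y \<in> place a c ` vertices k"
      unfolding place_vertices using xy by (cases x; cases y; simp)+
    then obtain u v where uv: "x = place a c u" "y = place a c v" by blast
    have "(\<pi> x, \<pi> y) \<in> conn (strand a b p)"
    proof (rule conn_map[where f = \<pi>])
      show "(x, y) \<in> conn ?A" using xy by blast
    qed (rule trans_conn, erule (2) edge)
    then obtain B where "B \<in> strand a b p" "place a b u \<in> B" "place a b v \<in> B"
      unfolding uv \<pi> conn_partition[OF part] by blast
    moreover from this(1) obtain B' where "B' \<in> p" "B = place a b ` B'"
      unfolding strand_def by blast
    ultimately have "B' \<in> p" "u \<in> B'" "v \<in> B'"
      using inj_image_mem_iff[OF inj_place[OF assms(1)]] by simp_all
    then show "\<exists>B\<in>strand a c p. x \<in> B \<and> y \<in> B"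
      unfolding strand_def uv by blast
  next
    assume "\<exists>B\<in>strand a c p. x \<in> B \<and> y \<in> B"
    then obtain B u v where B: "B \<in> p" "u \<in> B" "v \<in> B" and uv: "x = place a c u" "y = place a c v"
      unfolding strand_def by blast
    \<comment> \<open>For the converse, a vertex placed in rows \<open>a\<close> and
      \<open>c\<close> is joined to its copy in rows \<open>a\<close> and \<open>b\<close>:
      trivially for a top vertex, by a vertical edge for a bottom one.\<close>
    have slide: "(place a b w, place a c w) \<in> conn ?A" if "w \<in> vertices k" for w
    proof (cases w)
      case (Top i)
      then have "(a, i) \<in> \<Union>?A" using that unfolding Union_Un_distrib U by (auto simp: vertices_def)
      then show ?thesis unfolding Top by (simp only: place.simps conn_refl)
    next
      case (Bottom i)
      then have "i \<in> {1..k}" using that by (auto simp: vertices_def)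
      then show ?thesis unfolding Bottom place.simps by (intro conn_strand_id) auto
    qed
    have "u \<in> vertices k" "v \<in> vertices k"
      using B partition_onD1[OF diagrams_partition[OF p]] by auto
    moreover have "(place a b u, place a b v) \<in> conn ?A"
      using B by (intro conn_edge[of "place a b ` B"]) (auto simp: strand_def)
    ultimately have "(x, y) \<in> conn ?A"
      unfolding uv by (blast intro: conn_trans[OF conn_sym[OF slide]] conn_trans[OF _ slide])
    moreover have "place a c w \<notin> row b" for w
      using assms(1,2) by (cases w) auto
    ultimately show "(x, y) \<in> conn ?A \<and> x \<notin> row b \<and> y \<notin> row b"
      unfolding uv by simp
  qed
qed

lemma compose_id_left:
  assumes "p \<in> diagrams k"
  shows "compose (id_diagram k) p = p"
proof -
  have "strand 0 2 (compose (id_diagram k) p) =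
      eliminate (row 1) (strand 0 1 p \<union> strand 1 2 (id_diagram k))"
    by (rule strand_compose) auto
  also have "\<dots> = strand 0 2 p"
    by (rule eliminate_strand_id[OF _ _ _ assms]) auto
  finally show ?thesis by (simp add: strand_eq_iff)
qed

text \<open>Turning \<open>p\<close> upside down gives \<open>q\<close>, and the stack read from row
  2 up to row 0 is then \<open>q\<close> followed by vertical edges, the situation of
  \<open>eliminate_strand_id\<close>.\<close>

lemma compose_id_right:
  assumes "p \<in> diagrams k"
  shows "compose p (id_diagram k) = p"
proof -
  define swap where "swap v = (case v of Top i \<Rightarrow> Bottom i | Bottom i \<Rightarrow> Top i)" for v :: "nat vertex"
  define q where "q = (`) swap ` p"
  have "place b a (swap v) = place a b v" for a b v
    by (cases v) (simp_all add: swap_def)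
  then have q: "strand b a q = strand a b p" for a b
    unfolding strand_def q_def image_image by simp
  have "partition_on ({2, 1} \<times> {1..k}) (strand 2 1 q)"
    using partition_on_strand[of 1 2 k p] assms unfolding q by (simp add: insert_commute)
  then have "q \<in> diagrams k"
    using partition_on_strand[of 2 1 k q] by simp
  then have "eliminate (row 1) (strand 2 1 q \<union> strand 1 0 (id_diagram k)) = strand 2 0 q"
    by (intro eliminate_strand_id) auto
  moreover have "strand 1 0 (id_diagram k) = strand 0 1 (id_diagram k)"
    unfolding strand_id_diagram by (simp add: insert_commute)
  moreover have "strand 0 2 (compose p (id_diagram k)) =
      eliminate (row 1) (strand 0 1 (id_diagram k) \<union> strand 1 2 p)"
    by (rule strand_compose) auto
  ultimately have "strand 0 2 (compose p (id_diagram k)) = strand 0 2 p"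
    by (simp only: q Un_commute)
  then show ?thesis by (simp add: strand_eq_iff)
qed

lemma nc_join_id_id: "nc_join_id k (id_diagram k) = k"
  by (simp add: nc_join_id_def components_diagram[OF id_diagram_diagrams] nc_id_diagram[unfolded nc_def])

text \<open>The block numbers cancel and leave minus \<open>kappa\<close>. Since the defect is
  nonnegative it must vanish, so \<open>kappa\<close> need not be computed directly.\<close>

lemma defect_id:
  assumes "p \<in> diagrams k"
  shows "defect k (id_diagram k) p = 0" "defect k p (id_diagram k) = 0"
proof -
  note id = id_diagram_diagrams[of k]
  have "defect k (id_diagram k) p = - int (kappa (id_diagram k) p)"
    "defect k p (id_diagram k) = - int (kappa p (id_diagram k))"
    by (simp_all add: defect_def compose_id_left[OF assms] compose_id_right[OF assms]
        nc_join_id_id nc_id_diagram)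
  then show "defect k (id_diagram k) p = 0" "defect k p (id_diagram k) = 0"
    using defect_nonneg[OF id assms] defect_nonneg[OF assms id] by linarith+
qed

subsection \<open>Juxtaposition\<close>

lemma strand_relabel: "strand a b (relabel f p) = (`) (map_prod id f) ` strand a b p"
proof -
  have "place a b (map_vertex f x) = map_prod id f (place a b x)" for x
    by (cases x) simp_all
  then show ?thesis unfolding strand_def relabel_def image_image by simp
qed

text \<open>\<open>compose_relabel\<close> covers permutations only; the shift of indices by
  \<open>k\<close> used in juxtaposition is injective but not surjective.\<close>

lemma compose_relabel_inj:
  assumes "inj f"
  shows "compose (relabel f p) (relabel f q) = relabel f (compose p q)"
proof -
  have inj: "inj (map_prod id f :: nat \<times> nat \<Rightarrow> nat \<times> nat)" using assms by (intro prod.inj_map) auto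
  have compose: "strand 0 2 (compose p q) = eliminate (row 1) (strand 0 1 q \<union> strand 1 2 p)" for p q
    by (rule strand_compose) auto
  have "strand 0 2 (compose (relabel f p) (relabel f q)) =
      eliminate (row 1) ((`) (map_prod id f) ` (strand 0 1 q \<union> strand 1 2 p))"
    unfolding compose strand_relabel image_Un ..
  also have "\<dots> = (`) (map_prod id f) ` eliminate (row 1) (strand 0 1 q \<union> strand 1 2 p)"
    by (rule eliminate_image[OF inj]) auto
  also have "\<dots> = strand 0 2 (relabel f (compose p q))"
    unfolding compose[symmetric] strand_relabel ..
  finally show ?thesis by (simp add: strand_eq_iff)
qed

lemma kappa_relabel_inj:
  assumes "inj f"
  shows "kappa (relabel f p) (relabel f q) = kappa p q"
proof -
  have inj: "inj (map_prod id f :: nat \<times> nat \<Rightarrow> nat \<times> nat)" using assms by (intro prod.inj_map) auto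
  have kappa: "kappa p q = card {C \<in> components (strand 0 1 q \<union> strand 1 2 p). C \<subseteq> row 1}" for p q
    by (rule kappa_strand) auto
  have sub: "map_prod id f ` C \<subseteq> row 1 \<longleftrightarrow> C \<subseteq> row 1" for C :: "(nat \<times> nat) set"
    by (auto simp: subset_eq)
  have "{C \<in> components (strand 0 1 (relabel f q) \<union> strand 1 2 (relabel f p)). C \<subseteq> row 1} =
      (`) (map_prod id f) ` {C \<in> components (strand 0 1 q \<union> strand 1 2 p). C \<subseteq> row 1}"
    unfolding strand_relabel image_Un[symmetric] components_image[OF inj] using sub by blast
  then show ?thesis
    unfolding kappa by (simp add: card_image inj_on_subset[OF inj_image_set[OF inj]])
qed

lemma components_Int_empty:
  assumes "\<Union>A \<inter> \<Union>B = {}"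
  shows "components A \<inter> components B = {}"
proof (rule equals0I)
  fix C assume C: "C \<in> components A \<inter> components B"
  then have "C \<noteq> {}" using partition_onD3[OF partition_on_components[of A]] by auto
  moreover have "C \<subseteq> \<Union>A" "C \<subseteq> \<Union>B"
    using C Union_components[of A] Union_components[of B] by blast+
  ultimately show False using assms by blast
qed

lemma card_components_disjoint_Un:
  assumes "\<Union>A \<inter> \<Union>B = {}" "finite (\<Union>A)" "finite (\<Union>B)"
  shows "card (components (A \<union> B)) = card (components A) + card (components B)"
  unfolding components_disjoint_Un[OF assms(1)]
  by (intro card_Un_disjoint finite_components assms components_Int_empty)

lemma compose_disjoint_Un:
  assumes "\<Union>(strand 0 1 p2 \<union> strand 1 2 p1) \<inter> \<Union>(strand 0 1 q2 \<union> strand 1 2 q1) = {}"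
  shows "compose (p1 \<union> q1) (p2 \<union> q2) = compose p1 p2 \<union> compose q1 q2"
proof -
  have compose: "strand 0 2 (compose p q) = eliminate (row 1) (strand 0 1 q \<union> strand 1 2 p)" for p q
    by (rule strand_compose) auto
  have "strand 0 1 (p2 \<union> q2) \<union> strand 1 2 (p1 \<union> q1) =
      (strand 0 1 p2 \<union> strand 1 2 p1) \<union> (strand 0 1 q2 \<union> strand 1 2 q1)"
    unfolding strand_Un by (simp only: Un_ac)
  then have "strand 0 2 (compose (p1 \<union> q1) (p2 \<union> q2)) = strand 0 2 (compose p1 p2 \<union> compose q1 q2)"
    unfolding strand_Un compose by (simp only: eliminate_disjoint_Un[OF assms] strand_Un)
  then show ?thesis by (simp add: strand_eq_iff)
qed

lemma kappa_disjoint_Un: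
  assumes "\<Union>(strand 0 1 p2 \<union> strand 1 2 p1) \<inter> \<Union>(strand 0 1 q2 \<union> strand 1 2 q1) = {}"
    and "finite (\<Union>(strand 0 1 p2 \<union> strand 1 2 p1))" "finite (\<Union>(strand 0 1 q2 \<union> strand 1 2 q1))"
  shows "kappa (p1 \<union> q1) (p2 \<union> q2) = kappa p1 p2 + kappa q1 q2"
proof -
  have kappa: "kappa p q = card {C \<in> components (strand 0 1 q \<union> strand 1 2 p). C \<subseteq> row 1}" for p q
    by (rule kappa_strand) auto
  let ?A = "strand 0 1 p2 \<union> strand 1 2 p1" and ?B = "strand 0 1 q2 \<union> strand 1 2 q1"
  have "strand 0 1 (p2 \<union> q2) \<union> strand 1 2 (p1 \<union> q1) = ?A \<union> ?B"
    unfolding strand_Un by (simp only: Un_ac)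
  then have "{C \<in> components (strand 0 1 (p2 \<union> q2) \<union> strand 1 2 (p1 \<union> q1)). C \<subseteq> row 1} =
      {C \<in> components ?A. C \<subseteq> row 1} \<union> {C \<in> components ?B. C \<subseteq> row 1}"
    unfolding components_disjoint_Un[OF assms(1), symmetric]
    by (simp only: components_disjoint_Un[OF assms(1)]) blast
  then show ?thesis
    unfolding kappa using components_Int_empty[OF assms(1)] finite_components[OF assms(2)]
      finite_components[OF assms(3)]
    by (simp only:) (rule card_Un_disjoint, auto)
qed

lemma juxtapose_eq: "juxtapose k p q = p \<union> relabel ((+) k) q"
  by (simp add: juxtapose_def)

lemma inj_relabel: "inj f \<Longrightarrow> inj (relabel f)"
  unfolding relabel_def by (intro inj_image_set vertex.inj_map)

lemma Union_diagram: "p \<in> diagrams k \<Longrightarrow> \<Union>p = vertices k"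
  using partition_onD1[OF diagrams_partition] by blast

lemma Union_relabel: "\<Union>(relabel f p) = map_vertex f ` \<Union>p"
  unfolding relabel_def by blast

lemma finite_vertices: "finite (vertices k)"
  by (simp add: vertices_def)

lemma vertices_Int_shift: "vertices k \<inter> map_vertex ((+) k) ` vertices l = {}"
  by (auto simp: vertices_def)

lemma strands_Int_shift:
  assumes "p1 \<in> diagrams k" "p2 \<in> diagrams k" "q1 \<in> diagrams l" "q2 \<in> diagrams l"
  shows "\<Union>(strand 0 1 p2 \<union> strand 1 2 p1) \<inter>
      \<Union>(strand 0 1 (relabel ((+) k) q2) \<union> strand 1 2 (relabel ((+) k) q1)) = {}"
    and "finite (\<Union>(strand 0 1 p2 \<union> strand 1 2 p1))"
    and "finite (\<Union>(strand 0 1 (relabel ((+) k) q2) \<union> strand 1 2 (relabel ((+) k) q1)))"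
proof -
  have U: "\<Union>(strand a b (relabel ((+) k) q)) = map_prod id ((+) k) ` ({a, b} \<times> {1..l})"
    if "q \<in> diagrams l" for a b q
    unfolding strand_relabel image_Union[symmetric] Union_strand[OF that] ..
  note * = Union_Un_distrib U[OF assms(3)] U[OF assms(4)] Union_strand[OF assms(1)] Union_strand[OF assms(2)]
  show "\<Union>(strand 0 1 p2 \<union> strand 1 2 p1) \<inter>
      \<Union>(strand 0 1 (relabel ((+) k) q2) \<union> strand 1 2 (relabel ((+) k) q1)) = {}"
    unfolding * by auto
  show "finite (\<Union>(strand 0 1 p2 \<union> strand 1 2 p1))"
    "finite (\<Union>(strand 0 1 (relabel ((+) k) q2) \<union> strand 1 2 (relabel ((+) k) q1)))"
    unfolding * by simp_all
qed

lemma compose_juxtapose: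
  assumes "p1 \<in> diagrams k" "p2 \<in> diagrams k" "q1 \<in> diagrams l" "q2 \<in> diagrams l"
  shows "compose (juxtapose k p1 q1) (juxtapose k p2 q2) = juxtapose k (compose p1 p2) (compose q1 q2)"
  unfolding juxtapose_eq compose_disjoint_Un[OF strands_Int_shift(1)[OF assms]]
  by (simp add: compose_relabel_inj)

lemma kappa_juxtapose:
  assumes "p1 \<in> diagrams k" "p2 \<in> diagrams k" "q1 \<in> diagrams l" "q2 \<in> diagrams l"
  shows "kappa (juxtapose k p1 q1) (juxtapose k p2 q2) = kappa p1 p2 + kappa q1 q2"
  unfolding juxtapose_eq kappa_disjoint_Un[OF strands_Int_shift[OF assms]]
  by (simp add: kappa_relabel_inj)

lemma atLeastAtMost_add: "{1..k + l} = {1..k} \<union> (+) k ` {1..l}" for k l :: nat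
  unfolding image_add_atLeastAtMost by auto

lemma juxtapose_id: "juxtapose k (id_diagram k) (id_diagram l) = id_diagram (k + l)"
  unfolding juxtapose_eq relabel_def id_diagram_image atLeastAtMost_add image_Un image_image
  by simp

lemma vertices_add: "vertices (k + l) = vertices k \<union> map_vertex ((+) k) ` vertices l"
  unfolding vertices_def atLeastAtMost_add image_Un image_image by auto

lemma card_relabel: "inj f \<Longrightarrow> card (relabel f p) = card p"
  unfolding relabel_def
  by (rule card_image) (rule inj_on_subset[OF inj_image_set[OF vertex.inj_map] subset_UNIV])

lemma components_relabel: "inj f \<Longrightarrow> components (relabel f p) = relabel f (components p)"
  unfolding relabel_def by (intro components_image vertex.inj_map)

lemma card_components_shift:
  assumes "\<Union>A = vertices k" "\<Union>B = vertices l"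
  shows "card (components (A \<union> relabel ((+) k) B)) = card (components A) + card (components B)"
proof -
  have "card (components (A \<union> relabel ((+) k) B)) = card (components A) + card (components (relabel ((+) k) B))"
    by (rule card_components_disjoint_Un)
      (simp_all add: assms Union_relabel vertices_Int_shift finite_vertices)
  then show ?thesis by (simp add: components_relabel card_relabel)
qed

text \<open>The two halves share no vertices and \<open>id_diagram (k + l)\<close> itself splits
  along them, so every term of the defect is additive.\<close>

lemma defect_juxtapose:
  assumes "p1 \<in> diagrams k" "p2 \<in> diagrams k" "q1 \<in> diagrams l" "q2 \<in> diagrams l"
  shows "defect (k + l) (juxtapose k p1 q1) (juxtapose k p2 q2) = defect k p1 p2 + defect l q1 q2"
proof -
  have nc: "nc (juxtapose k p q) = nc p + nc q" if "p \<in> diagrams k" "q \<in> diagrams l" for p q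
    using card_components_shift[OF Union_diagram[OF that(1)] Union_diagram[OF that(2)]]
      components_diagram[OF that(1)] components_diagram[OF that(2)]
      components_diagram[OF juxtapose_diagrams[OF that]]
    by (simp add: nc_def juxtapose_eq)
  have join: "nc_join_id (k + l) (juxtapose k p q) = nc_join_id k p + nc_join_id l q"
    if "p \<in> diagrams k" "q \<in> diagrams l" for p q
  proof -
    have "juxtapose k p q \<union> id_diagram (k + l) = (p \<union> id_diagram k) \<union> relabel ((+) k) (q \<union> id_diagram l)"
      unfolding juxtapose_id[symmetric] juxtapose_eq relabel_def image_Un by (simp only: Un_ac)
    then show ?thesis
      unfolding nc_join_id_def using that Union_diagram[OF id_diagram_diagrams]
      by (simp only:) (intro card_components_shift; simp add: Union_diagram)
  qed
  show ?thesis
    unfolding defect_def kappa_juxtapose[OF assms] compose_juxtapose[OF assms]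
    using assms by (simp add: nc join compose_diagrams)
qed

text \<open>Blocks are nonempty, so each lies on exactly one side and shows which factor it came
  from; this makes juxtaposition injective.\<close>

lemma juxtapose_blocks:
  assumes "p \<in> diagrams k" "q \<in> diagrams l"
  shows "p = {B \<in> juxtapose k p q. B \<subseteq> vertices k}"
    and "relabel ((+) k) q = {B \<in> juxtapose k p q. \<not> B \<subseteq> vertices k}"
proof -
  have p: "B \<subseteq> vertices k" if "B \<in> p" for B
    using that Union_diagram[OF assms(1)] by blast
  have q: "\<not> B \<subseteq> vertices k" if B: "B \<in> relabel ((+) k) q" for B
  proof -
    have "B \<subseteq> map_vertex ((+) k) ` vertices l"
      using B Union_relabel[of "(+) k" q] Union_diagram[OF assms(2)] by auto
    moreover have "B \<noteq> {}"
      using B partition_onD3[OF diagrams_partition[OF assms(2)]] unfolding relabel_def by auto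
    ultimately show ?thesis using vertices_Int_shift[of k l] by blast
  qed
  show "p = {B \<in> juxtapose k p q. B \<subseteq> vertices k}"
    "relabel ((+) k) q = {B \<in> juxtapose k p q. \<not> B \<subseteq> vertices k}"
    unfolding juxtapose_eq using p q by blast+
qed

lemma juxtapose_inject:
  assumes "p \<in> diagrams k" "p' \<in> diagrams k" "q \<in> diagrams l" "q' \<in> diagrams l"
    and "juxtapose k p q = juxtapose k p' q'"
  shows "p = p'" "q = q'"
proof -
  show "p = p'"
    using juxtapose_blocks(1)[OF assms(1,3)] juxtapose_blocks(1)[OF assms(2,4)] assms(5) by simp
  have "relabel ((+) k) q = relabel ((+) k) q'"
    using juxtapose_blocks(2)[OF assms(1,3)] juxtapose_blocks(2)[OF assms(2,4)] assms(5) by simp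
  then show "q = q'" using inj_relabel[of "(+) k"] by (simp add: inj_eq)
qed

section \<open>Factorizations of a juxtaposition are juxtapositions\<close>

lemma partition_on_filter:
  assumes "partition_on V P" "\<Union>{B \<in> P. Q B} = W"
  shows "partition_on W {B \<in> P. Q B}"
  using assms unfolding partition_on_def disjoint_def by simp

lemma Union_filter_side:
  assumes "\<Union>r = V \<union> W" "V \<inter> W = {}" "\<And>B. B \<in> r \<Longrightarrow> B \<subseteq> V \<or> B \<subseteq> W"
  shows "\<Union>{B \<in> r. B \<subseteq> V} = V"
proof
  show "V \<subseteq> \<Union>{B \<in> r. B \<subseteq> V}"
  proof
    fix x assume x: "x \<in> V"
    then obtain B where "B \<in> r" "x \<in> B" using assms(1) by blast
    moreover from this have "B \<subseteq> V" using assms(2,3) x by blast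
    ultimately show "x \<in> \<Union>{B \<in> r. B \<subseteq> V}" by blast
  qed
qed blast

lemma juxtapose_split:
  assumes r: "r \<in> diagrams (k + l)"
    and split: "\<And>B. B \<in> r \<Longrightarrow> B \<subseteq> vertices k \<or> B \<subseteq> map_vertex ((+) k) ` vertices l"
  obtains p q where "p \<in> diagrams k" "q \<in> diagrams l" "r = juxtapose k p q"
proof -
  let ?p = "{B \<in> r. B \<subseteq> vertices k}" and ?s = "{B \<in> r. B \<subseteq> map_vertex ((+) k) ` vertices l}"
  \<comment> \<open>The truncated subtraction inverts the shift on indices above \<open>k\<close>,
    and no other indices occur in \<open>?s\<close>.\<close>
  define q where "q = relabel (\<lambda>i. i - k) ?s"
  have part: "partition_on (vertices (k + l)) r" by (rule diagrams_partition[OF r])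
  have U: "\<Union>r = vertices k \<union> map_vertex ((+) k) ` vertices l"
    unfolding vertices_add[symmetric] by (rule Union_diagram[OF r])
  have Up: "\<Union>?p = vertices k"
    by (rule Union_filter_side[OF U vertices_Int_shift split])
  have Us: "\<Union>?s = map_vertex ((+) k) ` vertices l"
    by (rule Union_filter_side[where W = "vertices k"])
      (use U vertices_Int_shift[of k l] split in \<open>simp_all only: Un_commute Int_commute disj_commute\<close>)
  have p: "partition_on (vertices k) ?p"
    by (rule partition_on_filter[OF part Up])
  have s: "partition_on (map_vertex ((+) k) ` vertices l) ?s"
    by (rule partition_on_filter[OF part Us])
  have "map_vertex ((+) k) (map_vertex (\<lambda>i. i - k) x) = x" if "x \<in> map_vertex ((+) k) ` vertices l" for x
    using that by (auto simp: vertex.map_comp vertices_def)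
  then have "map_vertex ((+) k) ` map_vertex (\<lambda>i. i - k) ` B = B" if "B \<in> ?s" for B
    using that unfolding image_image by (auto simp: subset_eq image_iff)
  then have q: "relabel ((+) k) q = ?s"
    unfolding q_def relabel_def image_image[of "(`) (map_vertex ((+) k))"] by simp
  have "partition_on (vertices l) q"
    using s unfolding q[symmetric] relabel_def
    by (subst (asm) partition_on_image_iff) (auto intro: vertex.inj_map)
  moreover have "r = juxtapose k ?p q"
    unfolding juxtapose_eq q using split by blast
  ultimately show thesis
    using that p by (auto simp: diagrams_def)
qed

fun index :: "'a vertex \<Rightarrow> 'a" where
  "index (Top i) = i"
| "index (Bottom i) = i"

text \<open>Two vertices in one block of \<open>r1\<close> or \<open>r2\<close> have their indices
  connected in the stack with vertical edges. With zero defect they are then connected in the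
  composite with vertical edges. The composite is a juxtaposition, so neither its blocks nor the
  vertical edges cross from \<open>1..k\<close> to \<open>k+1..k+l\<close>.\<close>

lemma factorization_index_side:
  assumes r1: "r1 \<in> diagrams (k + l)" and r2: "r2 \<in> diagrams (k + l)"
    and p: "p \<in> diagrams k" and q: "q \<in> diagrams l"
    and comp: "compose r1 r2 = juxtapose k p q" and defect: "defect (k + l) r1 r2 = 0"
    and B: "B \<in> r1 \<or> B \<in> r2" "u \<in> B" "v \<in> B"
  shows "index u \<le> k \<longleftrightarrow> index v \<le> k"
proof -
  let ?I = "id_diagram (k + l)"
  define G where "G = strand 0 1 r2 \<union> strand 1 2 r1 \<union> strand 1 2 ?I \<union> strand 0 1 ?I"
  define H where "H = strand 0 2 (juxtapose k p q) \<union> strand 0 2 ?I"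
  have i1: "((0, i), (1, i)) \<in> conn G" and i2: "((1, i), (2, i)) \<in> conn G" if "i \<in> {1..k + l}" for i
    using that by (auto intro!: conn_strand_id simp: G_def)
  have i0: "((0, i), (0, i)) \<in> conn G" if "i \<in> {1..k + l}" for i
    using i1[OF that] conn_sym conn_trans by fast
  \<comment> \<open>Vertical edges move every vertex of the stack to the vertex of row 0 with the
    same index, because \<open>defect_eq_0D\<close> speaks about outer rows only.\<close>
  have slide: "((0, index w), place a (Suc a) w) \<in> conn G"
    if w: "w \<in> vertices (k + l)" and a: "a = 0 \<or> a = 1" for w a
  proof -
    have "index w \<in> {1..k + l}" using w by (auto simp: vertices_def)
    note i1[OF this] i0[OF this] conn_trans[OF i1[OF this] i2[OF this]]
    then show ?thesis using a by (cases w) (auto simp: numeral_2_eq_2)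
  qed
  \<comment> \<open>\<open>a\<close> is the upper row of the diagram containing \<open>B\<close>: 0
    for \<open>r2\<close> and 1 for \<open>r1\<close>. Writing 2 as a successor lets
    \<open>Suc a\<close> denote the lower row in both cases.\<close>
  obtain a where a: "a = 0 \<or> a = 1" "strand a (Suc a) {B} \<subseteq> G"
    using B(1) unfolding G_def strand_def numeral_2_eq_2 by force
  have uv: "u \<in> vertices (k + l)" "v \<in> vertices (k + l)"
    using B Union_diagram[OF r1] Union_diagram[OF r2] by blast+
  have "(place a (Suc a) u, place a (Suc a) v) \<in> conn G"
    using a(2) B by (intro conn_edge[of "place a (Suc a) ` B"]) (auto simp: strand_def)
  then have "((0, index u), (0, index v)) \<in> conn G"
    by (rule conn_trans[OF conn_trans[OF slide[OF uv(1) a(1)]] conn_sym[OF slide[OF uv(2) a(1)]]])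
  moreover have "index u \<in> {1..k + l}" "index v \<in> {1..k + l}"
    using uv by (auto simp: vertices_def)
  ultimately have "((0, index u), (0, index v)) \<in> conn H"
    using defect_eq_0D[OF r1 r2 defect, of "(0, index u)" "(0, index v)"]
    unfolding G_def H_def comp by simp
  then have "(snd (0 :: nat, index u) \<le> k, snd (0 :: nat, index v) \<le> k) \<in> Id"
  \<comment> \<open>The side of an index is constant along edges of \<open>H\<close>: a block lies
    wholly on the left or wholly on the right, and a vertical edge keeps the index fixed.\<close>
  proof (rule conn_map[where f = "\<lambda>z. snd z \<le> k"])
    fix C x y assume C: "C \<in> H" "x \<in> C" "y \<in> C"
    have snd_place: "snd (place 0 2 w) = index w" for w by (cases w) simp_all
    have "(\<forall>w\<in>C. snd w \<le> k) \<or> (\<forall>w\<in>C. \<not> snd w \<le> k) \<or> (\<exists>i. \<forall>w\<in>C. snd w = i)"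
    proof -
      consider D where "D \<in> p" "C = place 0 2 ` D" | D where "D \<in> relabel ((+) k) q" "C = place 0 2 ` D"
        | i where "C = {(0, i), (2, i)}"
        using C(1) unfolding H_def strand_id_diagram unfolding strand_def juxtapose_eq by blast
      then show ?thesis
      proof cases
        case 1
        then have "D \<subseteq> vertices k" using Union_diagram[OF p] by blast
        then have "index w \<le> k" if "w \<in> D" for w using that by (auto simp: vertices_def)
        then show ?thesis using 1 snd_place by auto
      next
        case 2
        then have "D \<subseteq> map_vertex ((+) k) ` vertices l"
          using Union_relabel[of "(+) k" q] Union_diagram[OF q] by auto
        then have "\<not> index w \<le> k" if "w \<in> D" for w using that by (auto simp: vertices_def)
        then show ?thesis using 2 snd_place by auto
      qed auto
    qed
    then show "(snd x \<le> k, snd y \<le> k) \<in> Id" using C(2,3) by auto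
  qed (rule trans_Id)
  then show ?thesis by simp
qed

lemma factorization_split:
  assumes r1: "r1 \<in> diagrams (k + l)" and r2: "r2 \<in> diagrams (k + l)"
    and p: "p \<in> diagrams k" and q: "q \<in> diagrams l"
    and comp: "compose r1 r2 = juxtapose k p q" and defect: "defect (k + l) r1 r2 = 0"
    and r: "r = r1 \<or> r = r2"
  obtains p' q' where "p' \<in> diagrams k" "q' \<in> diagrams l" "r = juxtapose k p' q'"
proof -
  have rd: "r \<in> diagrams (k + l)" using r r1 r2 by blast
  show thesis
  proof (rule juxtapose_split[OF rd])
    fix B assume B: "B \<in> r"
    have side: "index u \<le> k \<longleftrightarrow> index v \<le> k" if "u \<in> B" "v \<in> B" for u v
      using factorization_index_side[OF r1 r2 p q comp defect _ that] B r by blast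
    have "B \<subseteq> vertices (k + l)" using B Union_diagram[OF rd] by blast
    moreover have "u \<in> vertices k \<longleftrightarrow> index u \<le> k" if "u \<in> vertices (k + l)" for u
      using that by (auto simp: vertices_def)
    ultimately show "B \<subseteq> vertices k \<or> B \<subseteq> map_vertex ((+) k) ` vertices l"
      using side unfolding vertices_add by blast
  qed (rule that)
qed

text \<open>This is the diagram-level counterpart of \<open>tensor_mult\<close>: the two middle
  factors are interchanged and then left and right parts are multiplied separately.\<close>

definition juxtapose_pairs :: "nat \<Rightarrow> (diagram \<times> diagram) \<times> (diagram \<times> diagram) \<Rightarrow> diagram \<times> diagram" where
  "juxtapose_pairs k = (\<lambda>((p1, p2), (q1, q2)). (juxtapose k p1 q1, juxtapose k p2 q2))"

text \<open>Multiplicativity of the coproduct before passing to orbits. Injectivity is that of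
  juxtaposition; for surjectivity \<open>factorization_split\<close> cuts both factors, and two
  nonnegative defects with sum zero both vanish.\<close>

lemma factorizations_juxtapose:
  assumes p: "p \<in> diagrams k" and q: "q \<in> diagrams l"
  shows "bij_betw (juxtapose_pairs k) (factorizations k p \<times> factorizations l q)
    (factorizations (k + l) (juxtapose k p q))"
  unfolding bij_betw_def
proof
  show "inj_on (juxtapose_pairs k) (factorizations k p \<times> factorizations l q)"
    by (rule inj_onI) (auto simp: juxtapose_pairs_def factorizations_iff dest: juxtapose_inject)
  show "juxtapose_pairs k ` (factorizations k p \<times> factorizations l q) =
      factorizations (k + l) (juxtapose k p q)"
  proof
    show "juxtapose_pairs k ` (factorizations k p \<times> factorizations l q) \<subseteq>
        factorizations (k + l) (juxtapose k p q)"
      by (auto simp: juxtapose_pairs_def factorizations_iff juxtapose_diagrams compose_juxtapose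
          defect_juxtapose)
    show "factorizations (k + l) (juxtapose k p q) \<subseteq>
        juxtapose_pairs k ` (factorizations k p \<times> factorizations l q)"
    proof clarify
      fix r1 r2 assume "(r1, r2) \<in> factorizations (k + l) (juxtapose k p q)"
      then have r: "r1 \<in> diagrams (k + l)" "r2 \<in> diagrams (k + l)"
        and comp: "compose r1 r2 = juxtapose k p q" and defect: "defect (k + l) r1 r2 = 0"
        by (auto simp: factorizations_iff)
      note split = factorization_split[OF r p q comp defect]
      obtain p1 q1 where 1: "p1 \<in> diagrams k" "q1 \<in> diagrams l" "r1 = juxtapose k p1 q1"
        using split[of r1] by blast
      obtain p2 q2 where 2: "p2 \<in> diagrams k" "q2 \<in> diagrams l" "r2 = juxtapose k p2 q2"
        using split[of r2] by blast
      have "juxtapose k (compose p1 p2) (compose q1 q2) = juxtapose k p q"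
        using comp unfolding 1(3) 2(3) compose_juxtapose[OF 1(1) 2(1) 1(2) 2(2)] .
      then have "compose p1 p2 = p" "compose q1 q2 = q"
        using juxtapose_inject[OF compose_diagrams[OF 1(1) 2(1)] p compose_diagrams[OF 1(2) 2(2)] q]
        by blast+
      moreover have "defect k p1 p2 + defect l q1 q2 = 0"
        using defect unfolding 1(3) 2(3) defect_juxtapose[OF 1(1) 2(1) 1(2) 2(2)] .
      then have "defect k p1 p2 = 0" "defect l q1 q2 = 0"
        using defect_nonneg[OF 1(1) 2(1)] defect_nonneg[OF 1(2) 2(2)] by linarith+
      ultimately have "((p1, p2), (q1, q2)) \<in> factorizations k p \<times> factorizations l q"
        using 1 2 by (simp add: factorizations_iff)
      then show "(r1, r2) \<in> juxtapose_pairs k ` (factorizations k p \<times> factorizations l q)"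
        by (rule rev_image_eqI) (simp add: juxtapose_pairs_def 1(3) 2(3))
    qed
  qed
qed

lemma juxtapose_assoc: "juxtapose (k + l) (juxtapose k p q) r = juxtapose k p (juxtapose l q r)"
proof -
  have "relabel ((+) (k + l)) r = relabel ((+) k) (relabel ((+) l) r)"
    unfolding relabel_relabel by (rule arg_cong[where f = "\<lambda>f. relabel f r"]) (simp add: fun_eq_iff)
  then show ?thesis
    unfolding juxtapose_eq by (simp add: relabel_def image_Un Un_assoc)
qed

subsection \<open>The bialgebra axioms\<close>

lemma linear_sum':
  assumes "Vector_Spaces.linear scale s f"
  shows "f (\<Sum>x\<in>A. g x) = (\<Sum>x\<in>A. f (g x))"
proof -
  interpret Vector_Spaces.linear scale s f by fact
  show ?thesis by (rule sum)
qed

lemma linear_eq_on_basis: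
  assumes "Vector_Spaces.linear scale s f" "Vector_Spaces.linear scale s g"
    and "\<And>x. f (basis x) = g (basis x)"
  shows "f v = g v"
  using lin_ext_unique[OF assms(1) assms(3)] lin_ext_unique[OF assms(2) refl] by simp

lemma linear_id: "Vector_Spaces.linear scale scale (\<lambda>v. v)"
  using vector_space_scale by (simp add: Vector_Spaces.linear_iff)

lemmas linear_comp = Vector_Spaces.linear_compose[unfolded o_def]

lemma linear_tensor_lift: "Vector_Spaces.linear scale scale (tensor_lift B)"
  unfolding tensor_lift_def by (rule lin_ext_linear[OF vector_space_scale])

lemma linear_tensor_lift_fun:
  assumes "\<And>x y. Vector_Spaces.linear scale scale (\<lambda>t. B t (basis x) (basis y))"
  shows "Vector_Spaces.linear scale scale (\<lambda>t. tensor_lift (B t) s)"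
  unfolding tensor_lift_def
  by (rule linear_lin_ext_fun) (simp add: case_prod_unfold assms)

lemma linear_tensor_map: "Vector_Spaces.linear scale scale (tensor_map f g)"
  unfolding tensor_map_def by (rule linear_tensor_lift)

lemma linear_tensor_assoc: "Vector_Spaces.linear scale scale tensor_assoc"
  unfolding tensor_assoc_def by (rule lin_ext_linear[OF vector_space_scale])

lemma tensor_lift_basis: "tensor_lift B (basis (x, y)) = B (basis x) (basis y)"
  by (simp add: tensor_lift_def lin_ext_basis vector_space_scale)

lemma tensor_assoc_basis: "tensor_assoc (basis ((x, y), z)) = basis (x, y, z)"
  by (simp add: tensor_assoc_def lin_ext_basis vector_space_scale)

lemma linear_tensor:
  "Vector_Spaces.linear scale scale (\<lambda>w. v \<otimes>\<^sub>t w)" "Vector_Spaces.linear scale scale (\<lambda>v. v \<otimes>\<^sub>t w)"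
  by (rule bilinear_tensor[unfolded bilinear_map_def, THEN conjunct1, THEN spec],
      rule bilinear_tensor[unfolded bilinear_map_def, THEN conjunct2, THEN spec])

lemma bilinear_tensor_mult: "bilinear_map (tensor_mult m)"
  unfolding bilinear_map_def
proof (intro conjI allI)
  show "Vector_Spaces.linear scale scale (tensor_mult m s)" for s
    unfolding tensor_mult_def by (intro linear_tensor_lift_fun linear_tensor_lift)
  show "Vector_Spaces.linear scale scale (\<lambda>s. tensor_mult m s t)" for t
    unfolding tensor_mult_def by (rule linear_tensor_lift)
qed

lemma linear_box_mult:
  "Vector_Spaces.linear scale scale (\<lambda>w. box_mult v w)"
  "Vector_Spaces.linear scale scale (\<lambda>v. box_mult v w)"
  unfolding box_mult_def
  by (rule bilinear_bilin_ext[unfolded bilinear_map_def, THEN conjunct1, THEN spec],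
      rule bilinear_bilin_ext[unfolded bilinear_map_def, THEN conjunct2, THEN spec])

lemma linear_box_comult: "Vector_Spaces.linear scale scale box_comult"
  unfolding box_comult_def by (rule lin_ext_linear[OF vector_space_scale])

lemma linear_box_counit: "Vector_Spaces.linear scale (*) box_counit"
  unfolding box_counit_def by (rule lin_ext_linear[OF vector_space_complex])

lemma linear_times: "Vector_Spaces.linear (*) (*) (\<lambda>x :: complex. c * x)"
  "Vector_Spaces.linear (*) (*) (\<lambda>x :: complex. x * c)"
  using vector_space_complex by (simp_all add: Vector_Spaces.linear_iff algebra_simps)

lemma box_comult_orbit':
  assumes "p \<in> diagrams k"
  shows "box_comult (basis (orbit_of k p)) =
    (\<Sum>(p1, p2)\<in>factorizations k p. basis (orbit_of k p1, orbit_of k p2))"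
  by (simp add: box_comult_orbit[OF assms] tensor_basis)

section \<open>Units, finiteness and rebracketing of factorizations\<close>

lemma empty_diagram: "{} \<in> diagrams 0"
  using id_diagram_diagrams[of 0] by (simp add: id_diagram_image)

lemma juxtapose_empty_left: "juxtapose 0 {} p = p"
proof -
  have "relabel (\<lambda>i. 0 + i) p = relabel id p"
    by (rule arg_cong[where f = "\<lambda>f. relabel f p"]) (simp add: fun_eq_iff)
  then show ?thesis by (simp add: juxtapose_def)
qed

lemma juxtapose_empty_right: "juxtapose k p {} = p"
  by (simp add: juxtapose_def relabel_def)

lemma factorizations_in_diagrams:
  "(p1, p2) \<in> factorizations k p \<Longrightarrow> p1 \<in> diagrams k"
  "(p1, p2) \<in> factorizations k p \<Longrightarrow> p2 \<in> diagrams k"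
  by (simp_all add: factorizations_iff)

lemma finite_factorizations: "finite (factorizations k p)"
  by (rule finite_subset[of _ "diagrams k \<times> diagrams k"])
    (auto simp: factorizations_iff finite_diagrams)

lemma factorizations_id_left:
  assumes "p \<in> diagrams k"
  shows "(id_diagram k, q) \<in> factorizations k p \<longleftrightarrow> q = p"
  using assms by (auto simp: factorizations_iff compose_id_left defect_id id_diagram_diagrams)

lemma factorizations_id_right:
  assumes "p \<in> diagrams k"
  shows "(q, id_diagram k) \<in> factorizations k p \<longleftrightarrow> q = p"
  using assms by (auto simp: factorizations_iff compose_id_right defect_id id_diagram_diagrams)

lemma factorizations_empty: "factorizations 0 {} = {({}, {})}"
proof -
  have "p = {}" if "p \<in> diagrams 0" for p
    using diagrams_partition[OF that] by (simp add: vertices_def partition_on_empty)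
  then have "p1 = {} \<and> p2 = {}" if "(p1, p2) \<in> factorizations 0 {}" for p1 p2
    using factorizations_in_diagrams[OF that] by blast
  moreover have "({}, {}) \<in> factorizations 0 {}"
    using factorizations_id_left[OF empty_diagram, of "{}"] by (simp add: id_diagram_image)
  ultimately show ?thesis by auto
qed

text \<open>Both sides run over triples with composite \<open>p\<close> for which both defects of a
  bracketing vanish. By the cocycle identity the two bracketings have the same total defect, and a
  sum of nonnegative defects is zero exactly when each one is.\<close>

lemma sum_factorizations_assoc:
  "(\<Sum>(q, p3)\<in>factorizations k p. \<Sum>(p1, p2)\<in>factorizations k q. f p1 p2 p3) =
    (\<Sum>(p1, q)\<in>factorizations k p. \<Sum>(p2, p3)\<in>factorizations k q. f p1 p2 p3)"
proof -
  have split: "defect k p1 p2 = 0 \<and> defect k (compose p1 p2) p3 = 0 \<longleftrightarrow>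
      defect k p2 p3 = 0 \<and> defect k p1 (compose p2 p3) = 0"
    if "p1 \<in> diagrams k" "p2 \<in> diagrams k" "p3 \<in> diagrams k" for p1 p2 p3
    using defect_cocycle[OF that] defect_nonneg[of p1 k p2]
      defect_nonneg[of "compose p1 p2" k p3] defect_nonneg[of p2 k p3]
      defect_nonneg[of p1 k "compose p2 p3"] that compose_diagrams
    by smt
  let ?L = "SIGMA x : factorizations k p. factorizations k (fst x)"
  let ?R = "SIGMA x : factorizations k p. factorizations k (snd x)"
  have "(\<Sum>(q, p3)\<in>factorizations k p. \<Sum>(p1, p2)\<in>factorizations k q. f p1 p2 p3) =
      (\<Sum>(x, y)\<in>?L. f (fst y) (snd y) (snd x))"
    by (simp add: sum.Sigma finite_factorizations case_prod_unfold)
  also have "\<dots> = (\<Sum>(x, y)\<in>?R. f (fst x) (fst y) (snd y))"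
  proof -
    \<comment> \<open>\<open>g\<close> and \<open>h\<close> change the bracketing: each forgets the
      intermediate product that indexes one sum and recomputes the one that indexes the
      other.\<close>
    define g where "g = (\<lambda>((q :: diagram, p3), (p1 :: diagram, p2)). ((p1, compose p2 p3), (p2, p3)))"
    define h where "h = (\<lambda>((p1, q :: diagram), (p2, p3 :: diagram)). ((compose p1 p2, p3), (p1, p2)))"
    have L: "h (g z) = z \<and> g z \<in> ?R \<and>
        (\<lambda>(x, y). f (fst x) (fst y) (snd y)) (g z) = (\<lambda>(x, y). f (fst y) (snd y) (snd x)) z"
      if zL: "z \<in> ?L" for z
    proof -
      obtain p1 p2 p3 where z: "z = ((compose p1 p2, p3), (p1, p2))"
        and d: "p1 \<in> diagrams k" "p2 \<in> diagrams k" "p3 \<in> diagrams k"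
        and *: "compose (compose p1 p2) p3 = p" "defect k (compose p1 p2) p3 = 0" "defect k p1 p2 = 0"
        using zL by (cases z) (auto simp: factorizations_iff)
      then show ?thesis
        using split[OF d] by (simp add: g_def h_def factorizations_iff compose_assoc compose_diagrams)
    qed
    have R: "g (h z) = z \<and> h z \<in> ?L" if zR: "z \<in> ?R" for z
    proof -
      obtain p1 p2 p3 where z: "z = ((p1, compose p2 p3), (p2, p3))"
        and d: "p1 \<in> diagrams k" "p2 \<in> diagrams k" "p3 \<in> diagrams k"
        and *: "compose p1 (compose p2 p3) = p" "defect k p1 (compose p2 p3) = 0" "defect k p2 p3 = 0"
        using zR by (cases z) (auto simp: factorizations_iff)
      then show ?thesis
        using split[OF d] by (simp add: g_def h_def factorizations_iff compose_assoc compose_diagrams)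
    qed
    show ?thesis
      by (rule sum.reindex_bij_witness[where i = h and j = g]) (use L R in blast)+
  qed
  also have "\<dots> = (\<Sum>(p1, q)\<in>factorizations k p. \<Sum>(p2, p3)\<in>factorizations k q. f p1 p2 p3)"
    by (simp add: sum.Sigma finite_factorizations case_prod_unfold)
  finally show ?thesis .
qed

section \<open>The axioms, checked on orbits and extended linearly\<close>

lemma box_mult_assoc: "box_mult (box_mult u v) w = box_mult u (box_mult v w)"
proof -
  \<comment> \<open>The identity is proved for three basis vectors; linearity then frees the
    variables one at a time, from the last to the first.\<close>
  have 3: "box_mult (box_mult (basis x) (basis y)) (basis z) = box_mult (basis x) (box_mult (basis y) (basis z))"
    for x y z
  proof -
    obtain k p where "p \<in> diagrams k" "x = orbit_of k p" by (rule orbit_cases)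
    moreover obtain l q where "q \<in> diagrams l" "y = orbit_of l q" by (rule orbit_cases)
    moreover obtain m r where "r \<in> diagrams m" "z = orbit_of m r" by (rule orbit_cases)
    ultimately show ?thesis
      by (simp add: box_mult_orbits juxtapose_diagrams juxtapose_assoc add.assoc)
  qed
  have 2: "box_mult (box_mult (basis x) (basis y)) w = box_mult (basis x) (box_mult (basis y) w)" for x y w
    by (rule linear_eq_on_basis[OF linear_box_mult(1) linear_comp[OF linear_box_mult(1) linear_box_mult(1)] 3])
  have 1: "box_mult (box_mult (basis x) v) w = box_mult (basis x) (box_mult v w)" for x v w
    by (rule linear_eq_on_basis[OF linear_comp[OF linear_box_mult(1) linear_box_mult(2)]
          linear_comp[OF linear_box_mult(2) linear_box_mult(1)] 2])
  show ?thesis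
    by (rule linear_eq_on_basis[OF linear_comp[OF linear_box_mult(2) linear_box_mult(2)]
          linear_box_mult(2) 1])
qed

lemma box_mult_unit: "box_mult box_unit v = v" "box_mult v box_unit = v"
proof -
  have "box_mult box_unit (basis x) = basis x" "box_mult (basis x) box_unit = basis x" for x
  proof -
    obtain k p where "p \<in> diagrams k" "x = orbit_of k p" by (rule orbit_cases)
    then show "box_mult box_unit (basis x) = basis x" "box_mult (basis x) box_unit = basis x"
      by (simp_all add: box_unit_def box_mult_orbits empty_diagram juxtapose_empty_left juxtapose_empty_right)
  qed
  then show "box_mult box_unit v = v" "box_mult v box_unit = v"
    using linear_eq_on_basis[OF linear_box_mult(1) linear_id] linear_eq_on_basis[OF linear_box_mult(2) linear_id]
    by blast+
qed

lemma box_comult_coassoc: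
  "tensor_assoc (tensor_map box_comult id (box_comult v)) = tensor_map id box_comult (box_comult v)"
proof (rule linear_eq_on_basis[OF linear_comp[OF linear_comp[OF linear_box_comult linear_tensor_map]
        linear_tensor_assoc] linear_comp[OF linear_box_comult linear_tensor_map]])
  fix x :: orbit
  obtain k p where p: "p \<in> diagrams k" and x: "x = orbit_of k p" by (rule orbit_cases)
  let ?b = "\<lambda>p1 p2 p3. basis (orbit_of k p1, orbit_of k p2, orbit_of k p3)"
  have "tensor_assoc (tensor_map box_comult id (basis (orbit_of k q, orbit_of k p3))) =
      (\<Sum>(p1, p2)\<in>factorizations k q. ?b p1 p2 p3)" if "q \<in> diagrams k" for q p3
    by (simp add: tensor_map_def tensor_lift_basis box_comult_orbit'[OF that]
        linear_sum'[OF linear_tensor(2)] linear_sum'[OF linear_tensor_assoc] case_prod_unfold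
        tensor_basis tensor_assoc_basis)
  then have "tensor_assoc (tensor_map box_comult id (box_comult (basis x))) =
      (\<Sum>(q, p3)\<in>factorizations k p. \<Sum>(p1, p2)\<in>factorizations k q. ?b p1 p2 p3)"
    unfolding x box_comult_orbit'[OF p] linear_sum'[OF linear_tensor_map] linear_sum'[OF linear_tensor_assoc]
    by (intro sum.cong refl) (auto dest: factorizations_in_diagrams)
  also have "\<dots> = (\<Sum>(p1, q)\<in>factorizations k p. \<Sum>(p2, p3)\<in>factorizations k q. ?b p1 p2 p3)"
    by (rule sum_factorizations_assoc)
  also have "\<dots> = tensor_map id box_comult (box_comult (basis x))"
  proof -
    have "tensor_map id box_comult (basis (orbit_of k p1, orbit_of k q)) =
        (\<Sum>(p2, p3)\<in>factorizations k q. ?b p1 p2 p3)" if "q \<in> diagrams k" for q p1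
      by (simp add: tensor_map_def tensor_lift_basis box_comult_orbit'[OF that]
          linear_sum'[OF linear_tensor(1)] case_prod_unfold tensor_basis)
    then show ?thesis
      unfolding x box_comult_orbit'[OF p] linear_sum'[OF linear_tensor_map]
      by (intro sum.cong refl) (auto dest: factorizations_in_diagrams)
  qed
  finally show "tensor_assoc (tensor_map box_comult id (box_comult (basis x))) =
      tensor_map id box_comult (box_comult (basis x))" .
qed

lemma scale_simps [simp]: "scale 1 v = v" "scale 0 v = 0"
  by (auto intro!: poly_mapping_eqI)

text \<open>The counit kills every factorization whose first factor is not the identity, and
  \<open>(id_diagram k, p)\<close> is the only one that survives.\<close>

lemma box_counit_left: "tensor_lift (\<lambda>u w. scale (box_counit u) w) (box_comult v) = v"
proof (rule linear_eq_on_basis[OF linear_comp[OF linear_box_comult linear_tensor_lift] linear_id])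
  fix x :: orbit
  obtain k p where p: "p \<in> diagrams k" and x: "x = orbit_of k p" by (rule orbit_cases)
  have "tensor_lift (\<lambda>u w. scale (box_counit u) w) (box_comult (basis x)) =
      (\<Sum>(p1, p2)\<in>factorizations k p. if (p1, p2) = (id_diagram k, p) then basis x else 0)"
    unfolding x box_comult_orbit'[OF p] linear_sum'[OF linear_tensor_lift]
    by (intro sum.cong refl)
      (auto simp: tensor_lift_basis box_counit_orbit factorizations_in_diagrams factorizations_id_left[OF p])
  also have "\<dots> = basis x"
    using factorizations_id_left[OF p, of p]
    by (simp add: case_prod_unfold finite_factorizations sum.delta flip: prod.inject)
  finally show "tensor_lift (\<lambda>u w. scale (box_counit u) w) (box_comult (basis x)) = basis x" .
qed

lemma box_counit_right: "tensor_lift (\<lambda>u w. scale (box_counit w) u) (box_comult v) = v"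
proof (rule linear_eq_on_basis[OF linear_comp[OF linear_box_comult linear_tensor_lift] linear_id])
  fix x :: orbit
  obtain k p where p: "p \<in> diagrams k" and x: "x = orbit_of k p" by (rule orbit_cases)
  have "tensor_lift (\<lambda>u w. scale (box_counit w) u) (box_comult (basis x)) =
      (\<Sum>(p1, p2)\<in>factorizations k p. if (p1, p2) = (p, id_diagram k) then basis x else 0)"
    unfolding x box_comult_orbit'[OF p] linear_sum'[OF linear_tensor_lift]
    by (intro sum.cong refl)
      (auto simp: tensor_lift_basis box_counit_orbit factorizations_in_diagrams factorizations_id_right[OF p])
  also have "\<dots> = basis x"
    using factorizations_id_right[OF p, of p]
    by (simp add: case_prod_unfold finite_factorizations sum.delta flip: prod.inject)
  finally show "tensor_lift (\<lambda>u w. scale (box_counit w) u) (box_comult (basis x)) = basis x" .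
qed

lemma box_comult_mult: "box_comult (box_mult u v) = tensor_mult box_mult (box_comult u) (box_comult v)"
proof (rule bilinear_eqI[where B = "\<lambda>u v. box_comult (box_mult u v)" and
      C = "\<lambda>u v. tensor_mult box_mult (box_comult u) (box_comult v)"])
  note linear_mult = bilinear_tensor_mult[of box_mult, unfolded bilinear_map_def]
  note linear_mult1 = linear_mult[THEN conjunct1, THEN spec]
  note linear_mult2 = linear_mult[THEN conjunct2, THEN spec]
  show "bilinear_map (\<lambda>u v. box_comult (box_mult u v))"
    unfolding bilinear_map_def
    by (intro conjI allI linear_comp[OF linear_box_mult(1) linear_box_comult]
        linear_comp[OF linear_box_mult(2) linear_box_comult])
  show "bilinear_map (\<lambda>u v. tensor_mult box_mult (box_comult u) (box_comult v))"
    unfolding bilinear_map_def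
    by (intro conjI allI linear_comp[OF linear_box_comult linear_mult1]
        linear_comp[OF linear_box_comult linear_mult2])
  fix x y :: orbit
  obtain k p where p: "p \<in> diagrams k" and x: "x = orbit_of k p" by (rule orbit_cases)
  obtain l q where q: "q \<in> diagrams l" and y: "y = orbit_of l q" by (rule orbit_cases)
  let ?b = "\<lambda>(p1, p2). basis (orbit_of (k + l) p1, orbit_of (k + l) p2)"
  have mult: "tensor_mult box_mult (basis (orbit_of k p1, orbit_of k p2)) (basis (orbit_of l q1, orbit_of l q2)) =
      ?b (juxtapose_pairs k ((p1, p2), (q1, q2)))"
    if "(p1, p2) \<in> factorizations k p" "(q1, q2) \<in> factorizations l q" for p1 p2 q1 q2
    using factorizations_in_diagrams[OF that(1)] factorizations_in_diagrams[OF that(2)]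
    by (simp add: tensor_mult_def tensor_lift_basis box_mult_orbits tensor_basis juxtapose_pairs_def)
  have "box_comult (box_mult (basis x) (basis y)) =
      (\<Sum>r\<in>factorizations (k + l) (juxtapose k p q). ?b r)"
    unfolding x y box_mult_orbits[OF p q] box_comult_orbit'[OF juxtapose_diagrams[OF p q]] ..
  also have "\<dots> = (\<Sum>z\<in>factorizations k p \<times> factorizations l q. ?b (juxtapose_pairs k z))"
    \<comment> \<open>Factorizations of the juxtaposition are replaced by pairs of factorizations of
      its two parts.\<close>
    by (rule sum.reindex_bij_betw[OF factorizations_juxtapose[OF p q], symmetric])
  also have "\<dots> = (\<Sum>a\<in>factorizations k p. \<Sum>c\<in>factorizations l q. ?b (juxtapose_pairs k (a, c)))"
    by (simp add: sum.cartesian_product case_prod_unfold)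
  also have "\<dots> = (\<Sum>a\<in>factorizations k p. \<Sum>c\<in>factorizations l q.
      tensor_mult box_mult (basis (orbit_of k (fst a), orbit_of k (snd a)))
        (basis (orbit_of l (fst c), orbit_of l (snd c))))"
    by (intro sum.cong refl) (simp add: mult)
  also have "\<dots> = tensor_mult box_mult (box_comult (basis x)) (box_comult (basis y))"
    unfolding x y box_comult_orbit'[OF p] box_comult_orbit'[OF q] case_prod_unfold
    \<comment> \<open>Expanding the product by linearity produces the double sum in the opposite
      nesting, hence the exchange of sums.\<close>
    by (simp only: linear_sum'[OF linear_mult1] linear_sum'[OF linear_mult2]) (rule sum.swap)
  finally show "box_comult (box_mult (basis x) (basis y)) =
      tensor_mult box_mult (box_comult (basis x)) (box_comult (basis y))" .
qed

lemma box_counit_mult: "box_counit (box_mult u v) = box_counit u * box_counit v"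
proof -
  have 2: "box_counit (box_mult (basis x) (basis y)) = box_counit (basis x) * box_counit (basis y)" for x y
  proof -
    obtain k p where p: "p \<in> diagrams k" and x: "x = orbit_of k p" by (rule orbit_cases)
    obtain l q where q: "q \<in> diagrams l" and y: "y = orbit_of l q" by (rule orbit_cases)
    \<comment> \<open>The identity is itself the juxtaposition of smaller identities, so injectivity
      of juxtaposition shows that both factors are identities.\<close>
    have "juxtapose k p q = id_diagram (k + l) \<longleftrightarrow> p = id_diagram k \<and> q = id_diagram l"
      using juxtapose_inject[OF p id_diagram_diagrams q id_diagram_diagrams]
      by (auto simp: juxtapose_id)
    then show ?thesis
      by (simp add: x y box_mult_orbits p q box_counit_orbit juxtapose_diagrams)
  qed
  have 1: "box_counit (box_mult (basis x) v) = box_counit (basis x) * box_counit v" for x v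
    by (rule linear_eq_on_basis[OF linear_comp[OF linear_box_mult(1) linear_box_counit]
          linear_comp[OF linear_box_counit linear_times(1)] 2])
  show ?thesis
    by (rule linear_eq_on_basis[OF linear_comp[OF linear_box_mult(2) linear_box_counit]
          linear_comp[OF linear_box_counit linear_times(2)] 1])
qed

theorem proposition4p2:
  shows "bialgebra box_mult box_unit box_comult box_counit"
proof (intro bialgebra.intro unital_algebra.intro counital_coalgebra.intro bialgebra_axioms.intro)
  show "bilinear_map box_mult"
    unfolding box_mult_def by (rule bilinear_bilin_ext)
  show "box_comult box_unit = box_unit \<otimes>\<^sub>t box_unit"
    by (simp add: box_unit_def box_comult_orbit'[OF empty_diagram] factorizations_empty tensor_basis)
  show "box_counit box_unit = 1"
    by (simp add: box_unit_def box_counit_orbit[OF empty_diagram] id_diagram_image)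
qed (rule box_mult_assoc box_mult_unit linear_box_comult linear_box_counit box_comult_coassoc
    box_counit_left box_counit_right box_comult_mult box_counit_mult)+

end
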